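(* Let $a<b$ be real, $\Omega=(a,b)$, and $1\le p\le4$. For each $\epsilon>0$ define $F_\epsilon:L^p(\Omega)\to[-\infty,\infty]$ by $$F_\epsilon(u):=\begin{cases}\int_\Omega\epsilon^{-1}(u^2-1)^2+\epsilon^3|u''|^2\,dx,& u\in W^{2,p}(\Omega),\\ +\infty,&\text{otherwise.}\end{cases}$$ Let $(\epsilon_n)$ be positive reals with $\epsilon_n\to0^+$. If $u_n\in L^p(\Omega)$ satisfy $\sup_{n}|F_{\epsilon_n}(u_n)|<\infty$, then there exist a subsequence $(u_{n_k})$ and $u\in BPV(\Omega;\{-1,1\})$ such that $u_{n_k}\to u$ in $L^p(\Omega)$.
   Context: For an interval $I$ and $v:I\to\mathbb{R}$, $\operatorname{Var}_I v:=\sup\{\sum_{i=1}^n|v(x_i)-v(x_{i-1})|: x_0<\dots<x_n\text{ in }I\}$; for $u\in L^1_{loc}(I)$, $\operatorname{essVar}_I u:=\inf\{\operatorname{Var}_I\tilde u:\tilde u\text{ a representative of }u\}$. $BPV(\Omega;\{-1,1\})$ is the set of $u\in L^p(\Omega)$ with $u\in\{-1,1\}$ a.e. and $\operatorname{essVar}_\Omega u<\infty$. *)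

theory Defs
  imports "HOL-Analysis.Analysis"
begin

definition Lp :: "real set \<Rightarrow> real \<Rightarrow> (real \<Rightarrow> real) \<Rightarrow> bool" where
  "Lp \<Omega> p u \<longleftrightarrow> u \<in> borel_measurable (lebesgue_on \<Omega>) \<and>
     integrable (lebesgue_on \<Omega>) (\<lambda>x. \<bar>u x\<bar> powr p)"

definition test_fun :: "real set \<Rightarrow> (real \<Rightarrow> real) \<Rightarrow> bool" where
  "test_fun \<Omega> \<phi> \<longleftrightarrow> (\<forall>k x. ((deriv ^^ k) \<phi>) differentiable (at x)) \<and>
     compact (closure {x. \<phi> x \<noteq> 0}) \<and> closure {x. \<phi> x \<noteq> 0} \<subseteq> \<Omega>"

definition weak_deriv :: "real set \<Rightarrow> (real \<Rightarrow> real) \<Rightarrow> (real \<Rightarrow> real) \<Rightarrow> bool" where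
  "weak_deriv \<Omega> u g \<longleftrightarrow>
     (\<forall>K. compact K \<and> K \<subseteq> \<Omega> \<longrightarrow> integrable (lebesgue_on K) u \<and> integrable (lebesgue_on K) g) \<and>
     (\<forall>\<phi>. test_fun \<Omega> \<phi> \<longrightarrow>
        (LINT x|lebesgue_on \<Omega>. u x * deriv \<phi> x) = - (LINT x|lebesgue_on \<Omega>. g x * \<phi> x))"

definition W2p :: "real set \<Rightarrow> real \<Rightarrow> (real \<Rightarrow> real) \<Rightarrow> bool" where
  "W2p \<Omega> p u \<longleftrightarrow> Lp \<Omega> p u \<and>
     (\<exists>g1 g2. Lp \<Omega> p g1 \<and> Lp \<Omega> p g2 \<and> weak_deriv \<Omega> u g1 \<and> weak_deriv \<Omega> g1 g2)"

text \<open>The (a.e. unique) weak second derivative of u.\<close>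
definition weak_deriv2 :: "real set \<Rightarrow> real \<Rightarrow> (real \<Rightarrow> real) \<Rightarrow> (real \<Rightarrow> real)" where
  "weak_deriv2 \<Omega> p u = (SOME g2. \<exists>g1. Lp \<Omega> p g1 \<and> Lp \<Omega> p g2 \<and>
       weak_deriv \<Omega> u g1 \<and> weak_deriv \<Omega> g1 g2)"

definition F_eps :: "real set \<Rightarrow> real \<Rightarrow> real \<Rightarrow> (real \<Rightarrow> real) \<Rightarrow> ereal" where
  "F_eps \<Omega> p \<epsilon> u = (if W2p \<Omega> p u then
      enn2ereal (\<integral>\<^sup>+ x. ennreal ((u x ^ 2 - 1) ^ 2 / \<epsilon> + \<epsilon> ^ 3 * \<bar>weak_deriv2 \<Omega> p u x\<bar> ^ 2)
                     \<partial>lebesgue_on \<Omega>)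
    else \<infinity>)"

definition var_on :: "real set \<Rightarrow> (real \<Rightarrow> real) \<Rightarrow> ereal" where
  "var_on I v = (SUP (n, x) \<in> {(n::nat, x::nat \<Rightarrow> real). (\<forall>i\<le>n. x i \<in> I) \<and> (\<forall>i<n. x i < x (Suc i))}.
       ereal (\<Sum>i\<in>{1..n}. \<bar>v (x i) - v (x (i - 1))\<bar>))"

definition ess_var_on :: "real set \<Rightarrow> (real \<Rightarrow> real) \<Rightarrow> ereal" where
  "ess_var_on I u = (INF v \<in> {v. AE x in lebesgue_on I. v x = u x}. var_on I v)"

definition BPV_pm1 :: "real set \<Rightarrow> real \<Rightarrow> (real \<Rightarrow> real) set" where
  "BPV_pm1 \<Omega> p = {u. Lp \<Omega> p u \<and> (AE x in lebesgue_on \<Omega>. u x \<in> {-1, 1}) \<and> ess_var_on \<Omega> u < \<infinity>}"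

end

theory Submission
  imports Defs
begin

text \<open>
  Each \<open>u\<^sub>n\<close> has a \<open>C\<^sup>1\<close> representative \<open>v\<close> whose derivative is an antiderivative of the weak second
  derivative. If \<open>v\<close> passes from below \<open>-1/2\<close> to above \<open>1/2\<close> and back, it has a critical point at the
  top of the bump, and this makes every such bump cost at least the energy \<open>1/16\<close>, independently of
  \<open>\<epsilon>\<close>. So \<open>v\<close> alternates between \<open>\<le> -1/2\<close> and \<open>\<ge> 1/2\<close> at most \<open>N\<close> times, with \<open>N\<close> depending only on
  the energy bound. The sign of \<open>v\<close> with hysteresis is a step function \<open>w\<^sub>n\<close> with at most \<open>N\<close> jumps and
  satisfies \<open>\<bar>v - w\<^sub>n\<bar>^4 \<le> 81 (v\<^sup>2 - 1)\<^sup>2\<close>, whose integral is \<open>O(\<epsilon>)\<close>. Along a subsequence the \<open>N\<close> jump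
  points converge, hence so do the \<open>w\<^sub>n\<close>, to a step function with at most \<open>N\<close> jumps.
\<close>

section \<open>Smooth functions and test functions\<close>

text \<open>The scaling x = \<epsilon> y turns the energy into the integral of (v^2 - 1)^2 +
  |v''|^2, free of \<epsilon>; this is why a fixed cost per oscillation can be expected. No term
  controls v', however: a steep affine v crosses from -1/2 to 1/2 on a short interval at arbitrarily
  small cost, so a single crossing carries no lower bound. A bump does, because its critical point
  gives a place with v' = 0 from which the second derivative must build up the slope. The plain sign
  of v would be useless as a step function: tiny oscillations around 0 cost almost nothing and may
  change sign arbitrarily often, and the band between -1/2 and 1/2 ignores them. The bound p \<le> 4
  enters since the well controls the fourth power of the distance to the step function, on an
  interval of finite measure. Pointwise values of v and v' have to be extracted from weak
  derivatives, which are tested only against smooth functions; this is why smooth bumps and the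
  lemma of du Bois-Reymond are built up before any energy estimate.\<close>

definition smooth :: "(real \<Rightarrow> real) \<Rightarrow> bool" where
  "smooth f \<longleftrightarrow> (\<forall>k x. ((deriv ^^ k) f) differentiable (at x))"

text \<open>Smoothness is an infinite conjunction over all orders, so it is treated coinductively:
  closure of a class under differentiation is enough, and no formula for the k-th derivative is
  needed.\<close>

lemma smooth_coinduct:
  assumes "P f"
    and step: "\<And>g. P g \<Longrightarrow> \<exists>g'. (\<forall>x. (g has_real_derivative g' x) (at x)) \<and> P g'"
  shows "smooth f"
proof -
  have *: "(\<forall>x. g differentiable (at x)) \<and> P (deriv g)" if Pg: "P g" for g
  proof -
    obtain g' where g': "\<forall>x. (g has_real_derivative g' x) (at x)" "P g'"
      using step[OF Pg] by blast
    then have "deriv g = g'" by (auto intro!: DERIV_imp_deriv)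
    with g' show ?thesis by (auto simp: real_differentiable_def)
  qed
  have "P ((deriv ^^ k) f)" for k
    by (induction k) (use assms(1) * in auto)
  then show ?thesis using * unfolding smooth_def by blast
qed

lemma smooth_has_deriv: "smooth f \<Longrightarrow> (f has_real_derivative deriv f x) (at x)"
  unfolding smooth_def using DERIV_deriv_iff_real_differentiable funpow_0 by metis

lemma smooth_deriv: "smooth f \<Longrightarrow> smooth (deriv f)"
  unfolding smooth_def by (metis comp_apply funpow_Suc_right)

lemma smooth_antideriv:
  assumes "smooth f" "\<And>x. (F has_real_derivative f x) (at x)"
  shows "smooth F"
proof (rule smooth_coinduct[where P = "\<lambda>g. g = F \<or> smooth g"])
  show "\<And>g. g = F \<or> smooth g \<Longrightarrow> \<exists>g'. (\<forall>x. (g has_real_derivative g' x) (at x)) \<and> (g' = F \<or> smooth g')"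
    using assms smooth_has_deriv smooth_deriv by blast
qed simp

lemma smooth_affine:
  assumes "smooth f"
  shows "smooth (\<lambda>x. c * f (m * x + q))"
proof (rule smooth_coinduct[where P = "\<lambda>h. \<exists>c g. smooth g \<and> h = (\<lambda>x. c * g (m * x + q))"])
  show "\<exists>c' g. smooth g \<and> (\<lambda>x. c * f (m * x + q)) = (\<lambda>x. c' * g (m * x + q))"
    using assms by blast
  fix h assume "\<exists>c g. smooth g \<and> h = (\<lambda>x. c * g (m * x + q))"
  then obtain c g where g: "smooth g" and h: "h = (\<lambda>x. c * g (m * x + q))" by blast
  have "(h has_real_derivative (c * m) * deriv g (m * x + q)) (at x)" for x
  proof -
    have "((\<lambda>x. m * x + q) has_real_derivative m) (at x)" by (auto intro!: derivative_eq_intros)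
    from DERIV_cmult[OF DERIV_chain2[OF smooth_has_deriv[OF g] this], of c]
    show ?thesis unfolding h by (simp add: mult_ac)
  qed
  then show "\<exists>g'. (\<forall>x. (h has_real_derivative g' x) (at x)) \<and>
              (\<exists>c g. smooth g \<and> g' = (\<lambda>x. c * g (m * x + q)))"
    using smooth_deriv[OF g] by (intro exI[of _ "\<lambda>x. (c * m) * deriv g (m * x + q)"] conjI) blast+
qed

text \<open>Products alone are not closed under differentiation; finite sums of products are, by the
  Leibniz rule. This is the class fed to \<open>smooth_coinduct\<close>.\<close>

inductive prod_span :: "(real \<Rightarrow> real) \<Rightarrow> bool" where
  mult: "smooth f \<Longrightarrow> smooth g \<Longrightarrow> prod_span (\<lambda>x. f x * g x)"
| add: "prod_span f \<Longrightarrow> prod_span g \<Longrightarrow> prod_span (\<lambda>x. f x + g x)"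

lemma smooth_prod_span:
  assumes "prod_span f" shows "smooth f"
proof (rule smooth_coinduct[where P = prod_span, OF assms])
  fix h assume "prod_span h"
  then show "\<exists>h'. (\<forall>x. (h has_real_derivative h' x) (at x)) \<and> prod_span h'"
  proof induction
    case (mult f g)
    have "((\<lambda>x. f x * g x) has_real_derivative deriv f x * g x + f x * deriv g x) (at x)" for x
      using DERIV_mult[OF smooth_has_deriv smooth_has_deriv, OF mult] by (simp add: mult.commute)
    moreover have "prod_span (\<lambda>x. deriv f x * g x + f x * deriv g x)"
      by (intro prod_span.intros mult smooth_deriv)
    ultimately show ?case by (intro exI[of _ "\<lambda>x. deriv f x * g x + f x * deriv g x"] conjI) blast+
  next
    case (add f g)
    then obtain f' g' where "\<forall>x. (f has_real_derivative f' x) (at x)" "prod_span f'"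
      "\<forall>x. (g has_real_derivative g' x) (at x)" "prod_span g'" by blast
    then show ?case
      by (intro exI[of _ "\<lambda>x. f' x + g' x"] conjI) (auto intro: DERIV_add prod_span.add)
  qed
qed

lemma smooth_mult: "smooth f \<Longrightarrow> smooth g \<Longrightarrow> smooth (\<lambda>x. f x * g x)"
  by (simp add: smooth_prod_span prod_span.mult)

lemma smooth_const: "smooth (\<lambda>x. c)"
  by (rule smooth_coinduct[where P = "\<lambda>f. \<exists>c. f = (\<lambda>x. c)"]) (auto intro!: exI[of _ "\<lambda>x. 0"])

lemma smooth_add:
  assumes "smooth f" "smooth g"
  shows "smooth (\<lambda>x. f x + g x)"
  using smooth_prod_span[OF prod_span.add[OF prod_span.mult[OF assms(1) smooth_const[of 1]]
          prod_span.mult[OF assms(2) smooth_const[of 1]]]] by simp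

section \<open>The flat function exp(-1/t) and the smooth ramps built from it\<close>

definition flat :: "real poly \<Rightarrow> real \<Rightarrow> real" where
  "flat Q t = (if t > 0 then poly Q (1 / t) * exp (- 1 / t) else 0)"

lemma poly_times_exp_tendsto_0:
  "((\<lambda>s::real. poly Q s * exp (- s)) \<longlongrightarrow> 0) at_top"
proof -
  have "((\<lambda>s::real. \<Sum>i\<le>degree Q. coeff Q i * (s ^ i / exp s)) \<longlongrightarrow> (\<Sum>i\<le>degree Q. coeff Q i * 0)) at_top"
    by (intro tendsto_intros tendsto_power_div_exp_0)
  then show ?thesis
    by (simp add: poly_altdef exp_minus sum_distrib_right divide_inverse mult.assoc)
qed

text \<open>A polynomial in s = 1/t is carried along to keep the family closed under
  differentiation: since ds/dt = -s^2, the derivative of Q(s) exp(-s) is s^2 (Q - Q')(s)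
  exp(-s).\<close>

lemma flat_has_deriv:
  "(flat Q has_real_derivative flat ([:0, 0, 1:] * (Q - pderiv Q)) t) (at t)"
proof -
  consider "t > 0" | "t < 0" | "t = 0" by linarith
  then show ?thesis
  proof cases
    case 1
    have "((\<lambda>t. poly Q (1 / t) * exp (- 1 / t)) has_real_derivative
           flat ([:0, 0, 1:] * (Q - pderiv Q)) t) (at t)"
      using 1 unfolding flat_def
      by (auto intro!: derivative_eq_intros poly_DERIV DERIV_chain2[OF poly_DERIV] simp: field_simps power2_eq_square)
    moreover have "\<forall>\<^sub>F s in nhds t. s > 0"
      using 1 eventually_nhds_in_open[of "{0<..}" t] by simp
    ultimately show ?thesis
      by (subst DERIV_cong_ev[OF refl _ refl, of _ "\<lambda>t. poly Q (1 / t) * exp (- 1 / t)"])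
        (auto elim!: eventually_mono simp: flat_def)
  next
    case 2
    have "\<forall>\<^sub>F s in nhds t. s < 0"
      using 2 eventually_nhds_in_open[of "{..<0}" t] by simp
    then show ?thesis using 2
      by (subst DERIV_cong_ev[OF refl _ refl, of _ "\<lambda>t. 0"])
        (auto elim!: eventually_mono simp: flat_def)
  next
    case 3
    \<comment> \<open>The polynomial \<open>pCons 0 Q\<close>, that is s Q(s), absorbs the division
      by h = 1/s in the difference quotient at 0.\<close>
    have "((\<lambda>h. poly (pCons 0 Q) (inverse h) * exp (- inverse h)) \<longlongrightarrow> 0) (at_right 0)"
      by (rule filterlim_compose[OF poly_times_exp_tendsto_0 filterlim_inverse_at_top_right])
    then have "((\<lambda>h. flat Q h / h) \<longlongrightarrow> 0) (at_right 0)"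
      by (rule Lim_transform_eventually)
        (auto simp: eventually_at_right_field flat_def field_simps intro!: exI[of _ 1])
    moreover have "((\<lambda>h. flat Q h / h) \<longlongrightarrow> 0) (at_left 0)"
      by (rule Lim_transform_eventually[of "\<lambda>_. 0"])
        (auto simp: eventually_at_left_field flat_def intro!: exI[of _ "-1"])
    ultimately have "((\<lambda>h. flat Q h / h) \<longlongrightarrow> 0) (at 0)"
      using filterlim_split_at by blast
    then show ?thesis using 3
      by (simp add: has_field_derivative_iff flat_def)
  qed
qed

lemma smooth_flat: "smooth (flat Q)"
  by (rule smooth_coinduct[where P = "\<lambda>f. \<exists>Q. f = flat Q"]) (use flat_has_deriv in blast)+

lemma antiderivative_exists:
  fixes f :: "real \<Rightarrow> real"
  assumes cont: "continuous_on UNIV f" and zero: "\<And>t. t \<le> 0 \<Longrightarrow> f t = 0"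
  obtains F where "\<And>x. (F has_real_derivative f x) (at x)" "\<And>t. t \<le> 0 \<Longrightarrow> F t = 0"
proof -
  \<comment> \<open>Any negative base point serves: every x \<ge> 0 is interior to {-1..x+1}, and
    near a negative x the function is constantly 0.\<close>
  define F where "F x = integral {-1..x} f" for x
  have F0: "F t = 0" if "t \<le> 0" for t
    unfolding F_def using that zero by (intro integral_unique has_integral_is_0) auto
  have "(F has_real_derivative f x) (at x)" for x
  proof (cases "x < 0")
    case True
    have "\<forall>\<^sub>F s in nhds x. s < 0"
      using True eventually_nhds_in_open[of "{..<0}" x] by simp
    then show ?thesis using True zero
      by (subst DERIV_cong_ev[OF refl _ refl, of _ "\<lambda>t. 0"]) (auto elim!: eventually_mono simp: F0)
  next
    case False
    have "(F has_real_derivative f x) (at x within {-1..x+1})"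
      unfolding F_def has_real_derivative_iff_has_vector_derivative
      using False by (intro integral_has_vector_derivative continuous_on_subset[OF cont]) auto
    then show ?thesis using False by (simp add: at_within_Icc_at)
  qed
  with F0 that show ?thesis by blast
qed

lemma smooth_continuous: "smooth f \<Longrightarrow> continuous_on S f"
  by (meson DERIV_continuous continuous_at_imp_continuous_on smooth_has_deriv)

text \<open>The derivative of V is the normalised integral of a bump on [0,1], hence a smooth cutoff
  from 0 to 1, and V is a smoothed positive part. Differences of rescaled copies of V serve later as
  smoothed primitives of indicators of intervals.\<close>

lemma smooth_ramp_exists:
  obtains V where "smooth V" "\<And>t. t \<le> 0 \<Longrightarrow> deriv V t = 0" "\<And>t. t \<ge> 1 \<Longrightarrow> deriv V t = 1"
    "\<And>t. 0 \<le> deriv V t" "\<And>t. deriv V t \<le> 1"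
    "\<And>t. t \<le> 0 \<Longrightarrow> V t = 0" "\<And>t. t \<ge> 1 \<Longrightarrow> V t = V 1 + (t - 1)"
proof -
  define B where "B t = flat 1 t * flat 1 (1 - t)" for t
  have B: "smooth B" unfolding B_def
    using smooth_mult[OF smooth_flat[of 1] smooth_affine[OF smooth_flat[of 1], of 1 "-1" 1]] by simp
  have B_nonneg: "B t \<ge> 0" for t by (auto simp: B_def flat_def)
  obtain F where F: "\<And>x. (F has_real_derivative B x) (at x)" "\<And>t. t \<le> 0 \<Longrightarrow> F t = 0"
    using antiderivative_exists[of B, OF smooth_continuous[OF B]] by (auto simp: B_def flat_def)
  have F_mono: "F s \<le> F t" if "s \<le> t" for s t
    using that F(1) B_nonneg DERIV_nonneg_imp_nondecreasing by blast
  have F_const: "F t = F 1" if t: "t \<ge> 1" for t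
  proof (cases "t = 1")
    case False
    then obtain z where "z > 1" "F t - F 1 = (t - 1) * B z"
      using MVT2[of 1 t F B] F(1) t by force
    then show ?thesis by (simp add: B_def flat_def)
  qed simp
  have c: "F 1 > 0"
  proof -
    obtain z where "0 < z" "z < 1" "F 1 - F 0 = (1 - 0) * B z"
      using MVT2[of 0 1 F B] F(1) by force
    then show ?thesis using F(2)[of 0] by (simp add: B_def flat_def)
  qed
  define T where "T t = F t / F 1" for t
  have F_smooth: "smooth F" using smooth_antideriv[OF B F(1)] .
  have T: "smooth T" using smooth_affine[OF F_smooth, of "1 / F 1" 1 0] by (simp add: T_def[abs_def])
  have T0: "T t = 0" if "t \<le> 0" for t using that F(2) by (simp add: T_def)
  obtain V where V: "\<And>x. (V has_real_derivative T x) (at x)" "\<And>t. t \<le> 0 \<Longrightarrow> V t = 0"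
    using antiderivative_exists[OF smooth_continuous[OF T] T0] by blast
  have dV: "deriv V = T" by (intro ext DERIV_imp_deriv V(1))
  have T1: "T t = 1" if "t \<ge> 1" for t using c F_const[OF that] by (simp add: T_def)
  show ?thesis
  proof (rule that)
    show "smooth V" by (rule smooth_antideriv[OF T V(1)])
    show "V t = V 1 + (t - 1)" if t: "t \<ge> 1" for t
    proof (cases "t = 1")
      case False
      then obtain z where "z > 1" "V t - V 1 = (t - 1) * T z"
        using MVT2[of 1 t V T] V(1) t by force
      then show ?thesis by (simp add: T1)
    qed simp
    fix t
    show "0 \<le> deriv V t" using F_mono[of "min t 0" t] F(2)[of "min t 0"] c by (simp add: dV T_def)
    show "deriv V t \<le> 1" using F_mono[of t "max t 1"] F_const[of "max t 1"] c by (simp add: dV T_def)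
  qed (simp_all add: dV T1 T0 V(2))
qed

lemma test_funI:
  assumes "smooth \<phi>" "a < lo" "hi < b" "\<And>t. t \<notin> {lo..hi} \<Longrightarrow> \<phi> t = 0"
  shows "test_fun {a<..<b} \<phi>"
proof -
  have "{x. \<phi> x \<noteq> 0} \<subseteq> {lo..hi}" using assms(4) by blast
  then have *: "closure {x. \<phi> x \<noteq> 0} \<subseteq> {lo..hi}" by (rule closure_minimal) simp
  then have "compact (closure {x. \<phi> x \<noteq> 0})"
    by (meson bounded_closed_interval bounded_subset closed_closure compact_eq_bounded_closed)
  then show ?thesis using assms * unfolding test_fun_def smooth_def by force
qed

section \<open>The lemma of du Bois-Reymond\<close>

text \<open>The measures with densities f^+ and f^- agree on all half-lines, which generate the
  Borel sets; so they are equal, and by uniqueness of densities so are f^+ and f^-.\<close>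

lemma AE_zero_if_Ioi_integrals_zero:
  fixes f :: "real \<Rightarrow> real"
  assumes f: "integrable lebesgue f"
    and zero: "\<And>x. (LINT t|lebesgue. indicator {x<..} t * f t) = 0"
  shows "AE x in lebesgue. f x = 0"
proof -
  \<comment> \<open>Uniqueness of measures is applied on the Borel sets, so f is exchanged for a
    Borel function equal to it almost everywhere.\<close>
  obtain g where g[measurable]: "g \<in> borel_measurable lborel" and fg: "AE x in lborel. f x = g x"
    using completion_ex_borel_measurable_real[of f lborel] borel_measurable_integrable[OF f] by blast
  have fg': "AE x in lebesgue. f x = g x" using fg by (rule AE_completion)
  have g': "g \<in> borel_measurable lebesgue" using g by (rule measurable_completion)
  have "integrable lebesgue g" by (rule integrable_cong_AE_imp[OF f g' fg'])
  then have gi: "integrable lborel g" by (subst (asm) integrable_completion[OF g])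
  have gz: "(LINT t|lborel. indicator {x<..} t * g t) = 0" for x
  proof -
    have ind: "indicat_real {x<..} \<in> borel_measurable lebesgue"
      by (intro measurable_completion borel_measurable_indicator) simp
    have "(LINT t|lborel. indicator {x<..} t * g t) = (LINT t|lebesgue. indicator {x<..} t * g t)"
      by (rule integral_completion[symmetric]) measurable
    also have "(LINT t|lebesgue. indicator {x<..} t * g t) = (LINT t|lebesgue. indicator {x<..} t * f t)"
      by (rule integral_cong_AE)
        (use fg' borel_measurable_integrable[OF f] g' ind in \<open>auto intro!: borel_measurable_times elim!: eventually_mono\<close>)
    finally show ?thesis using zero by simp
  qed
  have nn: "(\<integral>\<^sup>+t. ennreal (indicator {x<..} t * g t) \<partial>lborel) = (\<integral>\<^sup>+t. ennreal (- (indicator {x<..} t * g t)) \<partial>lborel)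
      \<and> (\<integral>\<^sup>+t. ennreal (- (indicator {x<..} t * g t)) \<partial>lborel) < top" for x
  proof -
    have i: "integrable lborel (\<lambda>t. indicator {x<..} t * g t)"
      using integrable_mult_indicator[OF _ gi, of "{x<..}"] by simp
    let ?p = "\<integral>\<^sup>+t. ennreal (indicator {x<..} t * g t) \<partial>lborel"
    let ?q = "\<integral>\<^sup>+t. ennreal (- (indicator {x<..} t * g t)) \<partial>lborel"
    have "?p < top" "?q < top" using i unfolding real_integrable_def by (simp_all add: less_top)
    moreover have "enn2real ?p = enn2real ?q"
      using gz[of x] unfolding real_lebesgue_integral_def[OF i] by simp
    ultimately show ?thesis by (metis ennreal_enn2real)
  qed
  have em: "emeasure (density lborel (\<lambda>t. ennreal (s * g t))) {x<..} = 
      (\<integral>\<^sup>+t. ennreal (s * (indicator {x<..} t * g t)) \<partial>lborel)" for s x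
    by (subst emeasure_density) (auto intro!: nn_integral_cong simp: indicator_def)
  \<comment> \<open>\<open>ennreal\<close> cuts negative values off at 0, so the factors 1 and -1
    produce the positive and the negative part of g.\<close>
  have "density lborel (\<lambda>t. ennreal (1 * g t)) = density lborel (\<lambda>t. ennreal ((-1) * g t))"
    by (rule measure_eqI_lessThan) (simp_all add: em[of 1, simplified] em[of "-1", simplified] nn)
  then have "AE t in lborel. ennreal (1 * g t) = ennreal ((-1) * g t)"
    by (subst (asm) sigma_finite_measure.density_unique_iff[OF sigma_finite_lborel]) auto
  then have "AE t in lborel. g t = 0"
    by eventually_elim (smt (verit, best) ennreal_eq_0_iff)
  with fg have "AE t in lborel. f t = 0" by eventually_elim simp
  then show ?thesis by (rule AE_completion)
qed

lemma integrable_mult_bounded: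
  fixes h w :: "'a \<Rightarrow> real"
  assumes h: "integrable M h" and w: "w \<in> borel_measurable M"
    and bound: "\<And>x. x \<in> space M \<Longrightarrow> \<bar>w x\<bar> \<le> C"
  shows "integrable M (\<lambda>x. h x * w x)"
proof (rule Bochner_Integration.integrable_bound[OF integrable_mult_left[OF integrable_abs[OF h], of C]])
  show "(\<lambda>x. h x * w x) \<in> borel_measurable M"
    using w borel_measurable_integrable[OF h] by simp
  show "AE x in M. norm (h x * w x) \<le> norm (\<bar>h x\<bar> * C)"
  proof (rule AE_I2)
    fix x assume "x \<in> space M"
    then have "\<bar>w x\<bar> \<le> \<bar>C\<bar>" using bound by force
    then show "norm (h x * w x) \<le> norm (\<bar>h x\<bar> * C)" by (simp add: abs_mult mult_left_mono)
  qed
qed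

lemma borel_measurable_lebesgue_on:
  "f \<in> borel_measurable borel \<Longrightarrow> f \<in> borel_measurable (lebesgue_on S)"
  by (intro measurable_restrict_space1 measurable_completion) simp

lemma smooth_measurable: "smooth f \<Longrightarrow> f \<in> borel_measurable (lebesgue_on S)"
  by (simp add: borel_measurable_lebesgue_on borel_measurable_continuous_onI smooth_continuous)

text \<open>The test functions \<open>\<phi>\<close> are chosen with \<open>\<phi>'\<close> a smoothed indicator of an interval minus a multiple
  of a fixed bump, so that \<open>\<integral> \<phi>' = 0\<close> makes \<open>\<phi>\<close> compactly supported.\<close>

lemma du_Bois_Reymond:
  fixes a b :: real
  assumes ab: "a < b" and h: "integrable (lebesgue_on {a<..<b}) h"
    and test: "\<And>\<phi>. test_fun {a<..<b} \<phi> \<Longrightarrow> (LINT x|lebesgue_on {a<..<b}. h x * deriv \<phi> x) = 0"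
  obtains c where "AE x in lebesgue_on {a<..<b}. h x = c"
proof -
  let ?M = "lebesgue_on {a<..<b}"
  obtain V where V: "smooth V" "\<And>t. t \<le> 0 \<Longrightarrow> deriv V t = 0" "\<And>t. t \<ge> 1 \<Longrightarrow> deriv V t = 1"
    "\<And>t. 0 \<le> deriv V t" "\<And>t. deriv V t \<le> 1"
    "\<And>t. t \<le> 0 \<Longrightarrow> V t = 0" "\<And>t. t \<ge> 1 \<Longrightarrow> V t = V 1 + (t - 1)"
    using smooth_ramp_exists by blast
  define T where "T = deriv V"
  have T: "smooth T" unfolding T_def by (rule smooth_deriv[OF V(1)])
  \<comment> \<open>\<open>P k x y\<close> is the smoothed indicator of (x, y), with layers of width
    1/k to the right of x and of y; \<open>W k x y\<close> is its primitive, equal to 0 before x and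
    to y - x after y + 1/k.\<close>
  define W where "W k x y t = (V (k * (t - x)) - V (k * (t - y))) / k" for k x y t
  define P where "P k x y t = T (k * (t - x)) - T (k * (t - y))" for k x y t
  have W_smooth: "smooth (W k x y)" for k x y
    using smooth_add[OF smooth_affine[OF V(1), of "1/k" k "-k*x"] smooth_affine[OF V(1), of "-1/k" k "-k*y"]]
    by (simp add: W_def[abs_def] field_simps diff_divide_distrib)
  have W_deriv: "(W k x y has_real_derivative P k x y t) (at t)" if "k > 0" for k x y t
  proof -
    have *: "((\<lambda>t. V (k * (t - z))) has_real_derivative T (k * (t - z)) * k) (at t)" for z
      unfolding T_def by (rule DERIV_chain2[OF smooth_has_deriv[OF V(1)]]) (auto intro!: derivative_eq_intros)
    have "(T (k * (t - x)) * k - T (k * (t - y)) * k) / k = P k x y t"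
      using \<open>k > 0\<close> by (simp add: P_def field_simps)
    with DERIV_cdivide[OF DERIV_diff[OF *[of x] *[of y]], of k]
    show ?thesis unfolding W_def[abs_def] by simp
  qed
  have W_left: "W k x y t = 0" if "k > 0" "t \<le> x" "x \<le> y" for k x y t
    using that by (simp add: W_def V(6) mult_nonneg_nonpos)
  have W_right: "W k x y t = y - x" if "k > 0" "t \<ge> y + 1 / k" "x \<le> y" for k x y t
  proof -
    have "k * (t - y) \<ge> 1" using that by (simp add: field_simps)
    moreover have "k * (t - x) \<ge> k * (t - y)" using that by simp
    ultimately have "W k x y t = (k * (t - x) - k * (t - y)) / k"
      using V(7)[of "k * (t - y)"] V(7)[of "k * (t - x)"] unfolding W_def by simp
    also have "k * (t - x) - k * (t - y) = k * (y - x)" by (simp add: algebra_simps)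
    finally show ?thesis using that by simp
  qed
  \<comment> \<open>The fixed reference bump lives on the middle half of the interval, from a +
    (b-a)/4 to a + 3(b-a)/4.\<close>
  define x0 y0 k0 where "x0 = a + (b - a) / 4" and "y0 = a + (b - a) / 2" and "k0 = 4 / (b - a)"
  have "1 / k0 = b / 4 - a / 4" "x0 = 3 * a / 4 + b / 4" "y0 = a / 2 + b / 2" "k0 > 0"
    using ab by (simp_all add: x0_def y0_def k0_def diff_divide_distrib)
  then have 0: "a < x0" "x0 < y0" "y0 + 1 / k0 < b" "k0 > 0"
    using ab by linarith+
  have T_bound: "\<bar>T t\<bar> \<le> 1" for t using V(4,5)[of t] by (simp add: T_def)
  have P_bound: "\<bar>P k x y t\<bar> \<le> 2" for k x y t
    using T_bound[of "k * (t - x)"] T_bound[of "k * (t - y)"] by (simp add: P_def)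
  have P_meas: "P k x y \<in> borel_measurable ?M" for k x y
    using smooth_add[OF smooth_affine[OF T, of 1 k "-k*x"] smooth_affine[OF T, of "-1" k "-k*y"]]
    by (intro smooth_measurable) (simp add: P_def[abs_def] right_diff_distrib)
  have hP: "integrable ?M (\<lambda>t. h t * P k x y t)" for k x y
    by (rule integrable_mult_bounded[OF h P_meas P_bound])
  define c where "c = (LINT t|?M. h t * P k0 x0 y0 t) / (y0 - x0)"
  have key: "(LINT t|?M. h t * P k x y t) = (y - x) * c"
    if k: "k > 0" and x: "a < x" and xy: "x \<le> y" and y: "y + 1 / k < b" for k x y
  proof -
    \<comment> \<open>With this factor both primitives reach the same plateau y - x on the right, so
      their difference vanishes there.\<close>
    define r where "r = (y - x) / (y0 - x0)"
    define \<phi> where "\<phi> t = W k x y t - r * W k0 x0 y0 t" for t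
    have "smooth \<phi>"
      unfolding \<phi>_def[abs_def] using smooth_add[OF W_smooth smooth_affine[OF W_smooth, of "-r" _ _ _ 1 0]] by simp
    moreover have "\<phi> t = 0" if "t \<notin> {min x x0 .. max (y + 1 / k) (y0 + 1 / k0)}" for t
    proof -
      have "t < min x x0 \<or> t > max (y + 1 / k) (y0 + 1 / k0)" using that by auto
      then show ?thesis
      proof
        assume "t < min x x0"
        then show ?thesis using W_left[of k t x y] W_left[of k0 t x0 y0] k xy 0 by (simp add: \<phi>_def)
      next
        assume "t > max (y + 1 / k) (y0 + 1 / k0)"
        then show ?thesis using W_right[of k y t x] W_right[of k0 y0 t x0] k xy 0 by (simp add: \<phi>_def r_def)
      qed
    qed
    ultimately have "test_fun {a<..<b} \<phi>"
      using x y 0 by (intro test_funI[of _ _ "min x x0" "max (y + 1 / k) (y0 + 1 / k0)"]) auto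
    from test[OF this] have "(LINT t|?M. h t * deriv \<phi> t) = 0" .
    moreover have "deriv \<phi> t = P k x y t - r * P k0 x0 y0 t" for t
      unfolding \<phi>_def[abs_def]
      using DERIV_diff[OF W_deriv[OF k] DERIV_cmult[OF W_deriv[OF 0(4)]]] by (rule DERIV_imp_deriv)
    ultimately have "(LINT t|?M. h t * P k x y t - r * (h t * P k0 x0 y0 t)) = 0"
      by (simp add: algebra_simps)
    then have "(LINT t|?M. h t * P k x y t) = r * (LINT t|?M. h t * P k0 x0 y0 t)"
      by (subst (asm) Bochner_Integration.integral_diff) (auto intro: hP integrable_mult_right)
    then show ?thesis by (simp add: r_def c_def)
  qed
  \<comment> \<open>The shifts 1/k and 2/k keep the support of \<open>P\<close> inside (a, b) even
    for x = a, since it ends at b - 2/k + 1/k < b. They disappear as k grows.\<close>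
  have tail: "(LINT t|?M. h t * indicator {x<..} t) = (b - x) * c" if x: "a \<le> x" "x < b" for x
  proof (rule LIMSEQ_unique)
    let ?k = "\<lambda>n. real (Suc n)"
    show "(\<lambda>n. LINT t|?M. h t * P (?k n) (x + 1 / ?k n) (b - 2 / ?k n) t) \<longlonglongrightarrow> (LINT t|?M. h t * indicator {x<..} t)"
    proof (rule integral_dominated_convergence[where w = "\<lambda>t. 2 * \<bar>h t\<bar>"])
      show "AE t in ?M. (\<lambda>n. h t * P (?k n) (x + 1 / ?k n) (b - 2 / ?k n) t) \<longlonglongrightarrow> h t * indicator {x<..} t"
      proof (rule AE_I2, rule tendsto_mult_left)
        fix t assume "t \<in> space ?M"
        then have t: "a < t" "t < b" by auto
        have E: "P (?k n) (x + 1 / ?k n) (b - 2 / ?k n) t = T (?k n * (t - x) - 1) - T (2 - ?k n * (b - t))" for n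
        proof -
          have *: "k * (t - (x + 1 / k)) = k * (t - x) - 1 \<and> k * (t - (b - 2 / k)) = 2 - k * (b - t)"
            if "k > 0" for k :: real
            using that by (simp add: field_simps)
          show ?thesis unfolding P_def using *[of "?k n"] by simp
        qed
        \<comment> \<open>The bound 2 saturates both cutoffs: T is 1 at k (t - x) - 1 \<ge> 1 and 0
          at 2 - k (b - t) \<le> 0.\<close>
        have inf: "\<forall>\<^sub>F n in sequentially. ?k n * e \<ge> 2" if "e > 0" for e :: real
        proof -
          obtain N where N: "2 / e \<le> real N" using real_arch_simple by blast
          have "?k n * e \<ge> 2" if n: "n \<ge> N" for n
          proof -
            have "2 \<le> real N * e" using N \<open>e > 0\<close> by (simp add: pos_divide_le_eq)
            also have "\<dots> \<le> ?k n * e" using n \<open>e > 0\<close> by (intro mult_right_mono) auto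
            finally show ?thesis .
          qed
          then show ?thesis by (rule eventually_sequentiallyI)
        qed
        have "\<forall>\<^sub>F n in sequentially. T (2 - ?k n * (b - t)) = 0"
          using inf[of "b - t"] t by (auto elim!: eventually_mono simp: T_def V(2))
        moreover have "\<forall>\<^sub>F n in sequentially. T (?k n * (t - x) - 1) = indicator {x<..} t"
        proof (cases "x < t")
          case True
          then show ?thesis using inf[of "t - x"] by (auto elim!: eventually_mono simp: T_def V(3))
        next
          case False
          then have "?k n * (t - x) \<le> 0" for n by (intro mult_nonneg_nonpos) auto
          then have "T (?k n * (t - x) - 1) = 0" for n
            unfolding T_def by (intro V(2)) (simp add: add_increasing2 order_trans[of _ 0 1])
          then show ?thesis using False by simp
        qed
        ultimately have "\<forall>\<^sub>F n in sequentially. P (?k n) (x + 1 / ?k n) (b - 2 / ?k n) t = indicator {x<..} t"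
          by eventually_elim (simp only: E)
        then show "(\<lambda>n. P (?k n) (x + 1 / ?k n) (b - 2 / ?k n) t) \<longlonglongrightarrow> indicator {x<..} t"
          by (rule tendsto_eventually)
      qed
      show "AE t in ?M. norm (h t * P (?k n) (x + 1 / ?k n) (b - 2 / ?k n) t) \<le> 2 * \<bar>h t\<bar>" for n
        using P_bound by (intro AE_I2) (simp add: abs_mult mult.commute[of "2"] mult_left_mono del: of_nat_Suc)
      show "integrable ?M (\<lambda>t. 2 * \<bar>h t\<bar>)" using h by simp
      show "(\<lambda>t. h t * P (?k n) (x + 1 / ?k n) (b - 2 / ?k n) t) \<in> borel_measurable ?M" for n
        using hP by (rule borel_measurable_integrable)
      show "(\<lambda>t. h t * indicator {x<..} t) \<in> borel_measurable ?M"
        by (intro borel_measurable_times borel_measurable_integrable[OF h] borel_measurable_lebesgue_on) simp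
    qed
    have "\<forall>\<^sub>F n in sequentially. 4 / (b - x) \<le> ?k n"
    proof -
      obtain N where "4 / (b - x) \<le> real N" using real_arch_simple by blast
      then show ?thesis by (intro eventually_sequentiallyI[of N]) linarith
    qed
    then have "\<forall>\<^sub>F n in sequentially. (b - 2 / ?k n - (x + 1 / ?k n)) * c = (LINT t|?M. h t * P (?k n) (x + 1 / ?k n) (b - 2 / ?k n) t)"
    proof eventually_elim
      case (elim n)
      define k where "k = ?k n"
      have k: "k > 0" "4 \<le> k * (b - x)" using elim x by (auto simp: k_def field_simps)
      have "1 / k + 2 / k \<le> 4 / k" "4 / k \<le> b - x"
        using k by (simp_all add: add_divide_distrib[symmetric] divide_le_cancel pos_divide_le_eq mult.commute)
      then have "x + 1 / k \<le> b - 2 / k" by linarith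
      moreover have "b - 2 / k + 1 / k < b" using k by (simp add: field_simps)
      moreover have "a < x + 1 / k" using divide_pos_pos[OF zero_less_one k(1)] x(1) by linarith
      ultimately show ?case using key[of k "x + 1 / k" "b - 2 / k"] k(1) unfolding k_def[symmetric] by simp
    qed
    moreover have "(\<lambda>n. (b - 2 / ?k n - (x + 1 / ?k n)) * c) \<longlonglongrightarrow> (b - 0 - (x + 0)) * c"
      by (intro tendsto_intros LIMSEQ_Suc[OF lim_const_over_n])
    ultimately show "(\<lambda>n. LINT t|?M. h t * P (?k n) (x + 1 / ?k n) (b - 2 / ?k n) t) \<longlonglongrightarrow> (b - x) * c"
      by (simp add: Lim_transform_eventually)
  qed
  let ?f = "\<lambda>t. indicator {a<..<b} t * (h t - c)"
  have hc: "integrable ?M (\<lambda>t. h t - c)"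
    by (intro Bochner_Integration.integrable_diff[OF h] finite_measure.integrable_const
        finite_measure_lebesgue_on) simp
  have "AE t in lebesgue. ?f t = 0"
  proof (rule AE_zero_if_Ioi_integrals_zero)
    show "integrable lebesgue ?f" using hc by (simp add: integrable_restrict_space)
    fix x :: real
    \<comment> \<open>A half-line starting left of a contains the whole interval, so
      \<open>tail\<close> at a covers it.\<close>
    define z where "z = max a x"
    have eq: "(LINT t|lebesgue. indicator {x<..} t * ?f t) = (LINT t|?M. h t * indicator {z<..} t - c * indicator {z<..} t)"
      by (subst integral_restrict_space) (auto intro!: Bochner_Integration.integral_cong simp: indicator_def z_def)
    show "(LINT t|lebesgue. indicator {x<..} t * ?f t) = 0"
    proof (cases "z < b")
      case True
      have "(LINT t|?M. indicator {z<..} t) = measure ?M ({z<..} \<inter> space ?M)"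
        by simp
      also have "{z<..} \<inter> space ?M = {z<..<b}" using True by (auto simp: z_def)
      also have "measure ?M {z<..<b} = b - z" using True
        by (subst measure_restrict_space) (auto simp: z_def)
      finally have i: "(LINT t|?M. indicator {z<..} t) = b - z" .
      have int: "integrable ?M (\<lambda>t. h t * indicator {z<..} t)"
        by (rule integrable_mult_bounded[OF h, of _ 1]) (auto intro!: borel_measurable_lebesgue_on simp: indicator_def)
      have int2: "integrable ?M (\<lambda>t. c * indicator {z<..} t)"
        by (rule integrable_mult_bounded[OF finite_measure.integrable_const[OF finite_measure_lebesgue_on], of _ _ 1])
          (auto intro!: borel_measurable_lebesgue_on simp: indicator_def)
      have "(LINT t|?M. h t * indicator {z<..} t - c * indicator {z<..} t) = 
        (LINT t|?M. h t * indicator {z<..} t) - c * (LINT t|?M. indicator {z<..} t)"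
        by (simp add: Bochner_Integration.integral_diff[OF int int2])
      then show ?thesis using tail[of z] True i eq by (simp add: z_def)
    next
      case False
      have "(LINT t|?M. h t * indicator {z<..} t - c * indicator {z<..} t) = (LINT t|?M. 0)"
        using False by (intro Bochner_Integration.integral_cong) (auto simp: indicator_def)
      then show ?thesis using eq by simp
    qed
  qed
  then have "AE t in ?M. h t = c"
    by (subst AE_restrict_space_iff) (auto elim!: eventually_mono simp: indicator_def)
  then show ?thesis by (rule that)
qed

section \<open>Regular representatives of Sobolev functions\<close>

text \<open>Bridge between the two integrals in play: weak derivatives and energies use the Lebesgue
  integral over the open interval, antiderivatives the gauge integral over closed ones. The
  endpoints are null.\<close>

lemma integral_indicator_subinterval:
  fixes f :: "real \<Rightarrow> real"
  assumes f: "integrable (lebesgue_on {a<..<b}) f" and xy: "a \<le> x" "y \<le> b"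
  shows "f absolutely_integrable_on {x..y}"
    and "(LINT t|lebesgue_on {a<..<b}. indicator {x<..<y} t * f t) = integral {x..y} f"
proof -
  have "set_integrable lebesgue {a<..<b} f"
    using f by (simp add: integrable_restrict_space set_integrable_def)
  then have *: "f absolutely_integrable_on {x<..<y}"
    by (rule set_integrable_subset) (use xy in auto)
  then show "f absolutely_integrable_on {x..y}"
    using absolutely_integrable_on_open_interval[where f = f and a = x and b = y] by (simp add: box_real)
  have "(LINT t|lebesgue_on {a<..<b}. indicator {x<..<y} t * f t) = (LINT t:{x<..<y}|lebesgue. f t)"
    unfolding set_lebesgue_integral_def
    by (subst integral_restrict_space)
      (use xy in \<open>auto intro!: Bochner_Integration.integral_cong simp: indicator_def\<close>)
  also have "\<dots> = integral {x<..<y} f" by (rule set_lebesgue_integral_eq_integral(2)[OF *])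
  finally show "(LINT t|lebesgue_on {a<..<b}. indicator {x<..<y} t * f t) = integral {x..y} f"
    by (simp add: integral_open_interval_real)
qed

lemma test_fun_smooth: "test_fun \<Omega> \<phi> \<Longrightarrow> smooth \<phi>"
  by (simp add: test_fun_def smooth_def)

lemma test_fun_zero: "test_fun \<Omega> \<phi> \<Longrightarrow> x \<notin> \<Omega> \<Longrightarrow> \<phi> x = 0"
  using closure_subset[of "{x. \<phi> x \<noteq> 0}"] unfolding test_fun_def by blast

lemma smooth_bounded_on_Icc:
  assumes "smooth f"
  obtains C where "\<And>x. x \<in> {a..b} \<Longrightarrow> \<bar>f x\<bar> \<le> C"
proof -
  have "bounded (f ` {a..b})"
    by (intro compact_imp_bounded compact_continuous_image smooth_continuous assms compact_Icc)
  then obtain C where "\<forall>y\<in>f ` {a..b}. norm y \<le> C" unfolding bounded_iff by blast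
  then show ?thesis by (intro that[of C]) simp
qed

text \<open>The antiderivative of a merely integrable g need not be differentiable everywhere, so
  integration by parts is done by Fubini over the triangle a < t < x < b. Integrating
  \<open>deriv \<phi>\<close> from t to b leaves -\<phi>(t), because \<phi> vanishes at b.\<close>

lemma integral_antideriv_mult_deriv:
  fixes a b :: real
  assumes ab: "a < b" and g: "integrable (lebesgue_on {a<..<b}) g" and \<phi>: "test_fun {a<..<b} \<phi>"
  shows "integrable (lebesgue_on {a<..<b}) (\<lambda>x. integral {a..x} g * deriv \<phi> x)"
    and "(LINT x|lebesgue_on {a<..<b}. integral {a..x} g * deriv \<phi> x) = - (LINT t|lebesgue_on {a<..<b}. g t * \<phi> t)"
proof -
  let ?M = "lebesgue_on {a<..<b}"
  interpret M: finite_measure ?M by (rule finite_measure_lebesgue_on) simp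
  interpret pair_sigma_finite ?M ?M ..
  have d\<phi>: "smooth (deriv \<phi>)" using \<phi> by (simp add: test_fun_smooth smooth_deriv)
  obtain C where C: "\<And>x. x \<in> {a..b} \<Longrightarrow> \<bar>deriv \<phi> x\<bar> \<le> C"
    using smooth_bounded_on_Icc[OF d\<phi>, of a b] by blast
  have fst_meas [measurable]: "fst \<in> borel_measurable (?M \<Otimes>\<^sub>M ?M)" "snd \<in> borel_measurable (?M \<Otimes>\<^sub>M ?M)"
    using measurable_compose[OF measurable_fst borel_measurable_lebesgue_on[of "\<lambda>x. x"]]
      measurable_compose[OF measurable_snd borel_measurable_lebesgue_on[of "\<lambda>x. x"]] by simp_all
  have [measurable]: "deriv \<phi> \<in> borel_measurable borel" "g \<in> borel_measurable ?M"
    using d\<phi> g by (auto intro!: borel_measurable_continuous_onI smooth_continuous)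
  define F where "F x t = g t * (indicator {..<x} t * deriv \<phi> x)" for x t
  \<comment> \<open>The integrand is g(t) times a factor bounded by C, so joint integrability
    reduces to that of g(t) on a product of finite measures.\<close>
  have "integrable (?M \<Otimes>\<^sub>M ?M) (\<lambda>p. g (snd p))"
    by (rule Fubini_integrable) (use g in simp_all)
  then have "integrable (?M \<Otimes>\<^sub>M ?M) (\<lambda>p. g (snd p) * ((if snd p < fst p then 1 else 0) * deriv \<phi> (fst p)))"
  proof (rule integrable_mult_bounded[where C = C and h = "\<lambda>p. g (snd p)"
          and w = "\<lambda>p. (if snd p < fst p then 1 else 0) * deriv \<phi> (fst p)"])
    show "(\<lambda>p. (if snd p < fst p then 1 else 0) * deriv \<phi> (fst p)) \<in> borel_measurable (?M \<Otimes>\<^sub>M ?M)"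
      by measurable
  qed (use C in \<open>force simp: space_pair_measure\<close>)
  also have "(\<lambda>p. g (snd p) * ((if snd p < fst p then 1 else 0) * deriv \<phi> (fst p))) = case_prod F"
    by (auto simp: F_def)
  finally have F: "integrable (?M \<Otimes>\<^sub>M ?M) (case_prod F)" .
  have 1: "(LINT t|?M. F x t) = integral {a..x} g * deriv \<phi> x" if "x \<in> {a<..<b}" for x
  proof -
    have "(LINT t|?M. F x t) = (LINT t|?M. (indicator {a<..<x} t * g t) * deriv \<phi> x)"
      by (intro Bochner_Integration.integral_cong) (auto simp: F_def indicator_def)
    also have "\<dots> = (LINT t|?M. indicator {a<..<x} t * g t) * deriv \<phi> x" by simp
    finally show ?thesis using integral_indicator_subinterval(2)[OF g, of a x] that by simp
  qed
  have 2: "(LINT x|?M. F x t) = - (g t * \<phi> t)" if t: "t \<in> {a<..<b}" for t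
  proof -
    have d: "integrable ?M (deriv \<phi>)"
      by (rule M.integrable_const_bound[where B = C]) (use C smooth_measurable[OF d\<phi>] in auto)
    have "(LINT x|?M. F x t) = (LINT x|?M. g t * (indicator {t<..<b} x * deriv \<phi> x))"
      by (intro Bochner_Integration.integral_cong) (auto simp: F_def indicator_def)
    also have "\<dots> = g t * integral {t..b} (deriv \<phi>)"
      using integral_indicator_subinterval(2)[OF d, of t b] t by simp
    also have "integral {t..b} (deriv \<phi>) = \<phi> b - \<phi> t"
      using t smooth_has_deriv[OF test_fun_smooth[OF \<phi>]]
      by (intro integral_unique fundamental_theorem_of_calculus)
        (auto simp: has_real_derivative_iff_has_vector_derivative[symmetric] intro: has_field_derivative_at_within)
    finally show ?thesis using test_fun_zero[OF \<phi>, of b] by simp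
  qed
  have "integrable ?M (\<lambda>x. LINT t|?M. F x t)" using integrable_fst[OF F] by simp
  then show "integrable ?M (\<lambda>x. integral {a..x} g * deriv \<phi> x)"
    by (rule Bochner_Integration.integrable_cong[THEN iffD1, rotated 2]) (auto simp: 1)
  have "(LINT x|?M. integral {a..x} g * deriv \<phi> x) = (LINT x|?M. LINT t|?M. F x t)"
    by (intro Bochner_Integration.integral_cong) (auto simp: 1)
  also have "\<dots> = (LINT t|?M. LINT x|?M. F x t)" by (rule Fubini_integral[OF F, symmetric])
  also have "\<dots> = (LINT t|?M. - (g t * \<phi> t))"
    by (intro Bochner_Integration.integral_cong) (auto simp: 2)
  finally show "(LINT x|?M. integral {a..x} g * deriv \<phi> x) = - (LINT t|?M. g t * \<phi> t)" by simp
qed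

lemma continuous_on_antideriv:
  fixes g :: "real \<Rightarrow> real"
  assumes "integrable (lebesgue_on {a<..<b}) g"
  shows "continuous_on {a..b} (\<lambda>x. integral {a..x} g)"
  by (rule indefinite_integral_continuous_1[OF set_lebesgue_integral_eq_integral(1)[OF
        integral_indicator_subinterval(1)[OF assms order_refl order_refl]]])

lemma integrable_continuous_open_interval:
  fixes f :: "real \<Rightarrow> real"
  assumes "continuous_on {a..b} f"
  shows "integrable (lebesgue_on {a<..<b}) f"
proof -
  have "f absolutely_integrable_on {a..b}"
    using absolutely_integrable_continuous[of a b f] assms by simp
  then have "f absolutely_integrable_on {a<..<b}"
    by (rule set_integrable_subset) auto
  then show ?thesis by (simp add: absolutely_integrable_imp_integrable)
qed

text \<open>The antiderivative of g also has weak derivative g, so its difference from u is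
  orthogonal to every \<open>deriv \<phi>\<close> and therefore constant almost everywhere.\<close>

lemma weak_deriv_imp_antideriv:
  fixes a b :: real
  assumes ab: "a < b" and u: "integrable (lebesgue_on {a<..<b}) u"
    and g: "integrable (lebesgue_on {a<..<b}) g" and weak: "weak_deriv {a<..<b} u g"
  obtains c where "AE x in lebesgue_on {a<..<b}. u x = c + integral {a..x} g"
proof -
  let ?M = "lebesgue_on {a<..<b}"
  have G: "integrable ?M (\<lambda>x. integral {a..x} g)"
    by (intro integrable_continuous_open_interval continuous_on_antideriv g)
  obtain c where "AE x in ?M. u x - integral {a..x} g = c"
  proof (rule du_Bois_Reymond[OF ab])
    show "integrable ?M (\<lambda>x. u x - integral {a..x} g)" using u G by simp
    fix \<phi> assume \<phi>: "test_fun {a<..<b} \<phi>"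
    have d\<phi>: "smooth (deriv \<phi>)" using \<phi> by (simp add: test_fun_smooth smooth_deriv)
    obtain C where C: "\<And>x. x \<in> {a..b} \<Longrightarrow> \<bar>deriv \<phi> x\<bar> \<le> C"
      using smooth_bounded_on_Icc[OF d\<phi>, of a b] by blast
    have ui: "integrable ?M (\<lambda>x. u x * deriv \<phi> x)"
      by (rule integrable_mult_bounded[OF u smooth_measurable[OF d\<phi>], of C]) (use C in auto)
    have "(LINT x|?M. (u x - integral {a..x} g) * deriv \<phi> x) = 
       (LINT x|?M. u x * deriv \<phi> x) - (LINT x|?M. integral {a..x} g * deriv \<phi> x)"
      by (simp add: left_diff_distrib Bochner_Integration.integral_diff[OF ui integral_antideriv_mult_deriv(1)[OF ab g \<phi>]])
    also have "(LINT x|?M. u x * deriv \<phi> x) = - (LINT x|?M. g x * \<phi> x)"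
      using weak \<phi> unfolding weak_deriv_def by blast
    finally show "(LINT x|?M. (u x - integral {a..x} g) * deriv \<phi> x) = 0"
      by (simp add: integral_antideriv_mult_deriv(2)[OF ab g \<phi>])
  qed
  then have "AE x in ?M. u x = c + integral {a..x} g" by eventually_elim simp
  then show ?thesis by (rule that)
qed

lemma Lp_imp_integrable:
  fixes a b p :: real
  assumes "Lp {a<..<b} p u" "p \<ge> 1"
  shows "integrable (lebesgue_on {a<..<b}) u"
proof -
  let ?M = "lebesgue_on {a<..<b}"
  have "finite_measure ?M" by (rule finite_measure_lebesgue_on) simp
  then have "integrable ?M (\<lambda>x. 1 + \<bar>u x\<bar> powr p)"
    using assms(1) by (intro Bochner_Integration.integrable_add finite_measure.integrable_const) (auto simp: Lp_def)
  then show ?thesis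
  proof (rule Bochner_Integration.integrable_bound)
    show "u \<in> borel_measurable ?M" using assms(1) by (simp add: Lp_def)
    have "\<bar>t\<bar> \<le> 1 + \<bar>t\<bar> powr p" for t :: real
    proof (cases "\<bar>t\<bar> \<le> 1")
      case False
      then have "\<bar>t\<bar> powr 1 \<le> \<bar>t\<bar> powr p" using assms(2) by (intro powr_mono) auto
      then show ?thesis using False by simp
    qed (simp add: add_increasing2)
    then show "AE x in ?M. norm (u x) \<le> norm (1 + \<bar>u x\<bar> powr p)"
      by (intro AE_I2) (simp add: add_nonneg_nonneg)
  qed
qed

text \<open>The weak derivative is integrated twice. After the first round g1 is replaced by its
  continuous representative v', so that the second antiderivative is differentiable at every point,
  not just almost everywhere.\<close>

lemma W2p_regular_representative:
  fixes a b p :: real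
  assumes ab: "a < b" and p: "p \<ge> 1" and u: "W2p {a<..<b} p u"
  obtains v v' where "AE x in lebesgue_on {a<..<b}. u x = v x"
    and "\<And>x. x \<in> {a<..<b} \<Longrightarrow> (v has_real_derivative v' x) (at x)"
    and "\<And>x y. a < x \<Longrightarrow> x \<le> y \<Longrightarrow> y < b \<Longrightarrow> v' y - v' x = integral {x..y} (weak_deriv2 {a<..<b} p u)"
    and "integrable (lebesgue_on {a<..<b}) (weak_deriv2 {a<..<b} p u)"
proof -
  let ?M = "lebesgue_on {a<..<b}"
  let ?g2 = "weak_deriv2 {a<..<b} p u"
  \<comment> \<open>With g2 outermost the existential matches the choice in
    \<open>weak_deriv2\<close>: the g1 obtained accompanies the very g2 that enters the
    energy.\<close>
  have "\<exists>g2 g1. Lp {a<..<b} p g1 \<and> Lp {a<..<b} p g2 \<and> weak_deriv {a<..<b} u g1 \<and> weak_deriv {a<..<b} g1 g2"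
    using u unfolding W2p_def by blast
  from someI_ex[OF this] obtain g1 where g1: "Lp {a<..<b} p g1" "Lp {a<..<b} p ?g2"
    "weak_deriv {a<..<b} u g1" "weak_deriv {a<..<b} g1 ?g2"
    unfolding weak_deriv2_def[symmetric] by blast
  have int: "integrable ?M u" "integrable ?M g1" "integrable ?M ?g2"
    using u g1 p by (auto intro: Lp_imp_integrable simp: W2p_def)
  obtain c1 where c1: "AE x in ?M. g1 x = c1 + integral {a..x} ?g2"
    using weak_deriv_imp_antideriv[OF ab int(2,3) g1(4)] .
  obtain c0 where c0: "AE x in ?M. u x = c0 + integral {a..x} g1"
    using weak_deriv_imp_antideriv[OF ab int(1,2) g1(3)] .
  define v' where "v' x = c1 + integral {a..x} ?g2" for x
  define v where "v x = c0 + integral {a..x} v'" for x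
  have v'_cont: "continuous_on {a..b} v'"
    unfolding v'_def[abs_def] by (intro continuous_intros continuous_on_antideriv int)
  have v'_int: "integrable ?M v'" by (rule integrable_continuous_open_interval[OF v'_cont])
  have eq: "integral {a..x} g1 = integral {a..x} v'" if "x \<in> {a<..<b}" for x
  proof -
    have "integral {a..x} g1 = (LINT t|?M. indicator {a<..<x} t * g1 t)"
      using integral_indicator_subinterval(2)[OF int(2), of a x] that by simp
    also have "\<dots> = (LINT t|?M. indicator {a<..<x} t * v' t)"
    proof (rule integral_cong_AE)
      show "AE t in ?M. indicator {a<..<x} t * g1 t = indicator {a<..<x} t * v' t"
        using c1 by eventually_elim (simp add: v'_def)
    qed (use int v'_int in \<open>auto intro!: borel_measurable_times borel_measurable_lebesgue_on[of "indicator _"]\<close>)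
    also have "\<dots> = integral {a..x} v'"
      using integral_indicator_subinterval(2)[OF v'_int, of a x] that by simp
    finally show ?thesis .
  qed
  show ?thesis
  proof (rule that)
    show "AE x in ?M. u x = v x"
      using c0 AE_space by eventually_elim (use eq in \<open>auto simp: v_def\<close>)
    show "(v has_real_derivative v' x) (at x)" if x: "x \<in> {a<..<b}" for x
    proof -
      have "((\<lambda>x. integral {a..x} v') has_real_derivative v' x) (at x within {a..b})"
        unfolding has_real_derivative_iff_has_vector_derivative
        using x by (intro integral_has_vector_derivative v'_cont) auto
      then have "((\<lambda>x. integral {a..x} v') has_real_derivative v' x) (at x)"
        using x by (simp add: at_within_Icc_at)
      then show ?thesis unfolding v_def[abs_def] by (auto intro!: derivative_eq_intros)
    qed
    show "v' y - v' x = integral {x..y} ?g2" if "a < x" "x \<le> y" "y < b" for x y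
    proof -
      have "?g2 integrable_on {a..y}"
        using integral_indicator_subinterval(1)[OF int(3), of a y] that
        by (intro set_lebesgue_integral_eq_integral(1)) auto
      from Henstock_Kurzweil_Integration.integral_combine[OF _ _ this, of x] show ?thesis
        using that by (simp add: v'_def)
    qed
  qed (rule int)
qed

section \<open>Energy cost of oscillations\<close>

text \<open>Expand the nonnegative integral of (g - m)^2, where m is the mean value of g.\<close>

lemma Cauchy_Schwarz_integral_Icc:
  fixes g :: "real \<Rightarrow> real"
  assumes xy: "x \<le> y" and g: "g integrable_on {x..y}" and g2: "(\<lambda>t. (g t)\<^sup>2) integrable_on {x..y}"
  shows "(integral {x..y} g)\<^sup>2 \<le> (y - x) * integral {x..y} (\<lambda>t. (g t)\<^sup>2)"
proof (cases "x = y")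
  case False
  define I where "I = integral {x..y} g"
  define m where "m = I / (y - x)"
  have eq: "(\<lambda>t. (g t - m)\<^sup>2) = (\<lambda>t. (g t)\<^sup>2 - (2 * m) * g t + m\<^sup>2)"
    by (auto simp: power2_diff algebra_simps)
  have "((\<lambda>t. (g t - m)\<^sup>2) has_integral (integral {x..y} (\<lambda>t. (g t)\<^sup>2) - (2 * m) * I + (y - x) *\<^sub>R m\<^sup>2)) {x..y}"
    unfolding eq I_def
    using has_integral_const_real[of "m\<^sup>2" x y] xy
    by (intro has_integral_add has_integral_diff has_integral_mult_right integrable_integral g g2) simp_all
  from has_integral_nonneg[OF this] have "0 \<le> integral {x..y} (\<lambda>t. (g t)\<^sup>2) - 2 * m * I + (y - x) * m\<^sup>2" by simp
  moreover have "(y - x) * m\<^sup>2 = m * I" "(y - x) * m = I" using False by (auto simp: m_def power2_eq_square)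
  ultimately have "m * I \<le> integral {x..y} (\<lambda>t. (g t)\<^sup>2)" by (simp add: mult.commute)
  then have "(y - x) * (m * I) \<le> (y - x) * integral {x..y} (\<lambda>t. (g t)\<^sup>2)"
    using xy by (intro mult_left_mono) auto
  moreover have "(y - x) * (m * I) = I\<^sup>2"
    using \<open>(y - x) * m = I\<close> by (metis mult.assoc power2_eq_square)
  ultimately show ?thesis by (simp add: I_def)
qed simp

text \<open>The function v and its second derivative g are separate arguments: v can be changed on a
  null set while g stays the weak derivative chosen in \<open>F_eps\<close>.\<close>

definition energy_density :: "real \<Rightarrow> (real \<Rightarrow> real) \<Rightarrow> (real \<Rightarrow> real) \<Rightarrow> real \<Rightarrow> real" where
  "energy_density \<epsilon> v g x = ((v x)\<^sup>2 - 1)\<^sup>2 / \<epsilon> + \<epsilon> ^ 3 * (g x)\<^sup>2"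

lemma energy_density_nonneg: "\<epsilon> > 0 \<Longrightarrow> 0 \<le> energy_density \<epsilon> v g x"
  by (simp add: energy_density_def)

lemma energy_density_ge_potential: "\<epsilon> > 0 \<Longrightarrow> ((v x)\<^sup>2 - 1)\<^sup>2 / \<epsilon> \<le> energy_density \<epsilon> v g x"
  by (simp add: energy_density_def)

lemma integral_Ioo_ge:
  fixes f :: "real \<Rightarrow> real"
  assumes "f integrable_on {x..y}" "x \<le> y" "\<And>t. x < t \<Longrightarrow> t < y \<Longrightarrow> c \<le> f t"
  shows "(y - x) * c \<le> integral {x..y} f"
proof -
  have "integral {x<..<y} (\<lambda>t. c) \<le> integral {x<..<y} f"
    using assms(1,3) by (intro integral_le) (auto simp: integrable_on_open_interval_real)
  then have "integral {x..y} (\<lambda>t. c) \<le> integral {x..y} f" by (simp only: integral_open_interval_real)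
  then show ?thesis using assms(2) by simp
qed

text \<open>If the transition from \<open>v \<ge> 1/2\<close> to \<open>v \<le> -1/2\<close> were cheap, it would have to be so fast that
  the small oscillation of \<open>v'\<close> keeps the slope large for a time \<open>\<epsilon>\<close> before it: this contradicts
  either \<open>v' = 0\<close> at the preceding maximum, or smallness of the double-well term.\<close>

lemma bump_energy_ge:
  fixes v v' g :: "real \<Rightarrow> real"
  assumes eps: "\<epsilon> > 0" and y: "y1 < y2" "y2 < y3"
    and dv: "\<And>x. x \<in> {y1..y3} \<Longrightarrow> (v has_real_derivative v' x) (at x)"
    and dv': "\<And>x y. y1 \<le> x \<Longrightarrow> x \<le> y \<Longrightarrow> y \<le> y3 \<Longrightarrow> v' y - v' x = integral {x..y} g"
    and g: "g integrable_on {y1..y3}" and g2: "(\<lambda>t. (g t)\<^sup>2) integrable_on {y1..y3}"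
    and v: "v y1 \<le> -1/2" "v y2 \<ge> 1/2" "v y3 \<le> -1/2"
  shows "1/16 \<le> integral {y1..y3} (energy_density \<epsilon> v g)"
proof (rule ccontr)
  let ?e = "energy_density \<epsilon> v g"
  define A where "A = integral {y1..y3} ?e"
  assume "\<not> ?thesis"
  then have A: "A < 1/16" by (simp add: A_def)
  have v_cont: "continuous_on S v" if "S \<subseteq> {y1..y3}" for S
    using that dv by (meson DERIV_isCont continuous_at_imp_continuous_on subsetD)
  have "(\<lambda>x. ((v x)\<^sup>2 - 1)\<^sup>2 / \<epsilon>) integrable_on {y1..y3}"
    using eps by (intro integrable_continuous_real continuous_intros v_cont) auto
  then have e_int: "?e integrable_on {y1..y3}"
    unfolding energy_density_def[abs_def]
    using integrable_on_cmult_left[OF g2, of "\<epsilon> ^ 3"] by (intro integrable_add) simp_all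
  have e_sub: "?e integrable_on {x..y}" if "y1 \<le> x" "y \<le> y3" for x y
    by (rule integrable_on_subinterval[OF e_int]) (use that in auto)
  have e_le: "integral {x..y} ?e \<le> A" if "y1 \<le> x" "y \<le> y3" for x y
    unfolding A_def using that eps
    by (intro integral_subset_le e_sub e_int) (auto simp: energy_density_nonneg)
  have ne: "{y1..y3} \<noteq> {}" using y by simp
  obtain m0 where m0: "m0 \<in> {y1..y3}" "\<And>x. x \<in> {y1..y3} \<Longrightarrow> v x \<le> v m0"
    using continuous_attains_sup[OF compact_Icc ne v_cont[OF order_refl]] by blast
  then have vm0: "v m0 \<ge> 1/2" using v(2) y by (meson atLeastAtMost_iff less_imp_le order_trans)
  have "m0 \<noteq> y1" "m0 \<noteq> y3" using vm0 v by auto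
  with m0(1) have m0': "y1 < m0" "m0 < y3" by auto
  have v'm0: "v' m0 = 0"
  proof (rule DERIV_local_max[OF dv[OF m0(1)], of "min (m0 - y1) (y3 - m0)"])
    show "\<forall>y. \<bar>m0 - y\<bar> < min (m0 - y1) (y3 - m0) \<longrightarrow> v y \<le> v m0"
      using m0(2) by (auto simp: abs_if split: if_splits)
  qed (use m0' in auto)
  \<comment> \<open>Here t is the first time after the maximum with v \<le> -1/2, and s the last
    time before t with v \<ge> 1/2; strictly between them v stays inside the band.\<close>
  define S where "S = {x \<in> {m0..y3}. v x \<le> -1/2}"
  have "closed S" unfolding S_def
    by (intro continuous_on_closed_Collect_le) (use m0' v_cont in auto)
  then have "compact S" unfolding S_def
    by (metis (no_types, lifting) bounded_closed_interval bounded_subset compact_eq_bounded_closed mem_Collect_eq subsetI)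
  moreover have "y3 \<in> S" using v m0' by (auto simp: S_def)
  ultimately obtain t where t: "t \<in> S" "\<And>x. x \<in> S \<Longrightarrow> t \<le> x"
    using compact_attains_inf[of S] by blast
  define R where "R = {x \<in> {m0..t}. 1/2 \<le> v x}"
  have t': "m0 \<le> t" "t \<le> y3" "v t \<le> -1/2" using t(1) by (auto simp: S_def)
  have "closed R" unfolding R_def
    by (intro continuous_on_closed_Collect_le) (use m0' v_cont t' in auto)
  then have "compact R" unfolding R_def
    by (metis (no_types, lifting) bounded_closed_interval bounded_subset compact_eq_bounded_closed mem_Collect_eq subsetI)
  moreover have "m0 \<in> R" using vm0 t' by (auto simp: R_def)
  ultimately obtain s where s: "s \<in> R" "\<And>x. x \<in> R \<Longrightarrow> x \<le> s"
    using compact_attains_sup[of R] by blast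
  have s': "m0 \<le> s" "s \<le> t" "v s \<ge> 1/2" using s(1) by (auto simp: R_def)
  have st: "s < t" using s' t' by (cases "s = t") auto
  have between: "\<bar>v x\<bar> < 1/2" if "s < x" "x < t" for x
  proof -
    have "x \<notin> S" "x \<notin> R" using t(2)[of x] s(2)[of x] that by auto
    then show ?thesis using that s' t' by (simp add: S_def R_def abs_less_iff)
  qed
  \<comment> \<open>In the band (v^2 - 1)^2 \<ge> (3/4)^2 = 9/16, so energy below 1/16 leaves less
    than \<epsilon>/9 for the crossing. As v drops by at least 1 there, its slope at some m is below
    -9/\<epsilon>.\<close>
  have "(t - s) * ((9/16) / \<epsilon>) \<le> integral {s..t} ?e"
  proof (rule integral_Ioo_ge)
    fix x assume "s < x" "x < t"
    then have "(v x)\<^sup>2 \<le> (1/2)\<^sup>2" using between[of x] by (intro abs_le_square_iff[THEN iffD1]) auto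
    then have "(3/4)\<^sup>2 \<le> (1 - (v x)\<^sup>2)\<^sup>2" by (intro power_mono) (auto simp: power2_eq_square)
    then have "(9/16) / \<epsilon> \<le> ((v x)\<^sup>2 - 1)\<^sup>2 / \<epsilon>"
      using eps by (intro divide_right_mono) (auto simp: power2_eq_square algebra_simps)
    also have "\<dots> \<le> ?e x" using eps by (rule energy_density_ge_potential)
    finally show "(9/16) / \<epsilon> \<le> ?e x" .
  qed (use st s' t' m0' in \<open>auto intro!: e_sub\<close>)
  also have "\<dots> \<le> A" using s' t' m0' by (intro e_le) auto
  also note A
  finally have short: "(t - s) * 9 < \<epsilon>" using eps by (simp add: field_simps)
  have "\<exists>m>s. m < t \<and> v t - v s = (t - s) * v' m"
    by (rule MVT2[OF st], rule dv) (use s' t' m0' in auto)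
  then obtain m where m: "s < m" "m < t" "v t - v s = (t - s) * v' m" by blast
  have "v' m < - 9 / \<epsilon>"
  proof (rule ccontr)
    assume "\<not> v' m < - 9 / \<epsilon>"
    then have "(t - s) * (- 9 / \<epsilon>) \<le> (t - s) * v' m" using st by (intro mult_left_mono) auto
    also have "\<dots> \<le> -1" using m(3) s' t' by linarith
    finally show False using short eps by (simp add: field_simps)
  qed
  \<comment> \<open>Within distance \<epsilon> of m, Cauchy-Schwarz bounds the change of v' by the
    square root of \<epsilon> / (16 \<epsilon>^3), that is by 1/(4 \<epsilon>); the slope thus stays
    below -8/\<epsilon>.\<close>
  have steep: "v' x \<le> - 8 / \<epsilon>" if x: "m0 \<le> x" "x \<le> m" "m - x \<le> \<epsilon>" for x
  proof -
    have sub: "{x..m} \<subseteq> {y1..y3}" using x m m0' t' by auto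
    have g2x: "(\<lambda>t. (g t)\<^sup>2) integrable_on {x..m}" "g integrable_on {x..m}"
      using integrable_on_subinterval[OF g2 sub] integrable_on_subinterval[OF g sub] by auto
    have "\<epsilon> ^ 3 * integral {x..m} (\<lambda>t. (g t)\<^sup>2) = integral {x..m} (\<lambda>t. \<epsilon> ^ 3 * (g t)\<^sup>2)" by simp
    also have "\<dots> \<le> integral {x..m} ?e"
      using x m m0' t' g2x eps
      by (intro integral_le e_sub integrable_on_cmult_left[of "\<lambda>t. (g t)\<^sup>2", simplified])
        (auto simp: energy_density_def)
    also have "\<dots> \<le> A" using x m m0' t' by (intro e_le) auto
    finally have G: "\<epsilon> ^ 3 * integral {x..m} (\<lambda>t. (g t)\<^sup>2) \<le> 1/16" using A by simp
    have "(v' m - v' x)\<^sup>2 \<le> (m - x) * integral {x..m} (\<lambda>t. (g t)\<^sup>2)"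
      using Cauchy_Schwarz_integral_Icc[OF x(2) g2x(2,1)] dv'[of x m] x m m0' t' by simp
    also have "\<dots> \<le> \<epsilon> * integral {x..m} (\<lambda>t. (g t)\<^sup>2)"
      using x by (intro mult_right_mono Henstock_Kurzweil_Integration.integral_nonneg g2x) auto
    finally have "\<epsilon>\<^sup>2 * (v' m - v' x)\<^sup>2 \<le> \<epsilon>\<^sup>2 * (\<epsilon> * integral {x..m} (\<lambda>t. (g t)\<^sup>2))"
      by (intro mult_left_mono) auto
    also have "\<dots> \<le> 1/16" using G by (simp add: power2_eq_square power3_eq_cube mult.assoc)
    finally have "(\<epsilon> * (v' m - v' x))\<^sup>2 \<le> (1/4)\<^sup>2" by (simp add: power_mult_distrib power_divide)
    then have "\<bar>\<epsilon> * (v' m - v' x)\<bar> \<le> 1/4" using abs_le_square_iff[of "\<epsilon> * (v' m - v' x)" "1/4"] by simp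
    moreover have "\<epsilon> * v' m < - 9" using \<open>v' m < - 9 / \<epsilon>\<close> eps by (simp add: field_simps)
    ultimately have "\<epsilon> * v' x \<le> -8" unfolding right_diff_distrib by linarith
    then show ?thesis using eps by (simp add: field_simps)
  qed
  have far: "m - m0 > \<epsilon>"
  proof (rule ccontr)
    assume "\<not> m - m0 > \<epsilon>"
    then have "v' m0 \<le> - 8 / \<epsilon>" using m s' by (intro steep) auto
    then show False using v'm0 eps by simp
  qed
  \<comment> \<open>Going back from m by more than \<epsilon>/2 at slope at most -8/\<epsilon> lifts
    v by at least 4, hence above 2, where the well term is at least 1/\<epsilon>. Over a length of
    \<epsilon>/2 this costs 1/2, more than the assumed 1/16.\<close>
  have "((m - \<epsilon>/2) - (m - \<epsilon>)) * (1 / \<epsilon>) \<le> integral {m - \<epsilon>..m - \<epsilon>/2} ?e"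
  proof (rule integral_Ioo_ge)
    fix x assume x: "m - \<epsilon> < x" "x < m - \<epsilon>/2"
    then have xm: "x < m" using eps by linarith
    have "\<exists>z>x. z < m \<and> v m - v x = (m - x) * v' z"
      by (rule MVT2[OF xm], rule dv) (use x far m m0' t' in auto)
    then obtain z where z: "x < z" "z < m" "v m - v x = (m - x) * v' z" by blast
    have "(m - x) * v' z \<le> (m - x) * (- 8 / \<epsilon>)"
      using z x far xm by (intro mult_left_mono steep) auto
    also have "\<dots> \<le> (\<epsilon> / 2) * (- 8 / \<epsilon>)" using x eps by (intro mult_right_mono_neg) (auto simp: divide_nonpos_pos)
    also have "\<dots> = -4" using eps by simp
    finally have "v x \<ge> 2" using z(3) between[of m] m by (auto simp: abs_less_iff)
    then have "2\<^sup>2 \<le> (v x)\<^sup>2" by (intro power_mono) auto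
    then have "1\<^sup>2 \<le> ((v x)\<^sup>2 - 1)\<^sup>2" by (intro power_mono) auto
    then have "1 / \<epsilon> \<le> ((v x)\<^sup>2 - 1)\<^sup>2 / \<epsilon>" using eps by (intro divide_right_mono) auto
    also have "\<dots> \<le> ?e x" using eps by (rule energy_density_ge_potential)
    finally show "1 / \<epsilon> \<le> ?e x" .
  qed (use eps far m m0' t' in \<open>auto intro!: e_sub\<close>)
  also have "\<dots> \<le> A" using eps far m m0' t' by (intro e_le) auto
  finally show False using A eps by simp
qed

text \<open>Unfolded: there are points y_1 \<le> ... \<le> y_j \<le> x in \<Omega> with v \<le> -1/2
  at odd and v \<ge> 1/2 at even indices. As x only bounds the last point, the predicate is monotone
  in x, and each j contributes a single jump point.\<close>

primrec alternates :: "real set \<Rightarrow> (real \<Rightarrow> real) \<Rightarrow> nat \<Rightarrow> real \<Rightarrow> bool" where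
  "alternates \<Omega> v 0 x \<longleftrightarrow> True"
| "alternates \<Omega> v (Suc j) x \<longleftrightarrow>
     (\<exists>y\<in>\<Omega>. y \<le> x \<and> alternates \<Omega> v j y \<and> (-1) ^ Suc j * v y \<ge> 1/2)"

lemma alternates_mono: "alternates \<Omega> v j x \<Longrightarrow> x \<le> y \<Longrightarrow> alternates \<Omega> v j y"
  by (cases j) (auto intro: order_trans)

lemma alternates_antimono: "alternates \<Omega> v k x \<Longrightarrow> j \<le> k \<Longrightarrow> alternates \<Omega> v j x"
proof (induction k)
  case (Suc k)
  then show ?case
    by (cases "j = Suc k") (auto intro: alternates_mono)
qed simp

text \<open>The 2q+1 points form q bumps low-high-low. Neighbouring bumps share a low point, so
  their intervals do not overlap and the costs of 1/16 add up. The low point y is part of the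
  conclusion because the next bump starts there.\<close>

lemma alternates_energy:
  fixes v v' g :: "real \<Rightarrow> real"
  assumes eps: "\<epsilon> > 0"
    and dv: "\<And>x. x \<in> {a<..<b} \<Longrightarrow> (v has_real_derivative v' x) (at x)"
    and dv': "\<And>x y. a < x \<Longrightarrow> x \<le> y \<Longrightarrow> y < b \<Longrightarrow> v' y - v' x = integral {x..y} g"
    and g: "g integrable_on {a..b}" and g2: "(\<lambda>t. (g t)\<^sup>2) integrable_on {a..b}"
    and e: "energy_density \<epsilon> v g integrable_on {a..b}"
    and alt: "alternates {a<..<b} v (2 * q + 1) x"
  shows "\<exists>y\<in>{a<..<b}. y \<le> x \<and> v y \<le> -1/2 \<and> real q / 16 \<le> integral {a..y} (energy_density \<epsilon> v g)"
  using alt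
proof (induction q arbitrary: x)
  case 0
  then obtain y where y: "y \<in> {a<..<b}" "y \<le> x" "v y \<le> -1/2" by auto
  have "0 \<le> integral {a..y} (energy_density \<epsilon> v g)"
    using y eps by (intro Henstock_Kurzweil_Integration.integral_nonneg integrable_on_subinterval[OF e] energy_density_nonneg) auto
  then show ?case using y by auto
next
  case (Suc q)
  have "2 * Suc q + 1 = Suc (Suc (2 * q + 1))" by simp
  from Suc.prems[unfolded this] obtain y3 where y3: "y3 \<in> {a<..<b}" "y3 \<le> x"
    "alternates {a<..<b} v (Suc (2 * q + 1)) y3" "(-1) ^ Suc (Suc (2 * q + 1)) * v y3 \<ge> 1/2"
    unfolding alternates.simps(2)[of _ _ "Suc (2 * q + 1)"] by blast
  from y3(3) obtain y2 where y2: "y2 \<in> {a<..<b}" "y2 \<le> y3"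
    "alternates {a<..<b} v (2 * q + 1) y2" "(-1) ^ Suc (2 * q + 1) * v y2 \<ge> 1/2"
    unfolding alternates.simps(2)[of _ _ "2 * q + 1"] by blast
  have vy: "v y3 \<le> -1/2" "v y2 \<ge> 1/2" using y3(4) y2(4) by simp_all
  from Suc.IH[OF y2(3)] obtain y1 where y1: "y1 \<in> {a<..<b}" "y1 \<le> y2" "v y1 \<le> -1/2"
    "real q / 16 \<le> integral {a..y1} (energy_density \<epsilon> v g)" by blast
  have lt: "y1 < y2" "y2 < y3" using y1 y2 y3 vy by (auto simp: less_le)
  have sub: "{y1..y3} \<subseteq> {a..b}" using y1 y3 by auto
  have "1/16 \<le> integral {y1..y3} (energy_density \<epsilon> v g)"
    using lt y1 y2 y3 vy eps
    by (intro bump_energy_ge[where v' = v' and ?y2.0 = y2] dv dv' integrable_on_subinterval[OF g sub] integrable_on_subinterval[OF g2 sub]) auto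
  moreover have "integral {a..y1} (energy_density \<epsilon> v g) + integral {y1..y3} (energy_density \<epsilon> v g) = integral {a..y3} (energy_density \<epsilon> v g)"
    using lt y1 y3 by (intro Henstock_Kurzweil_Integration.integral_combine integrable_on_subinterval[OF e]) auto
  ultimately show ?case using y1 y3 vy by (auto intro!: bexI[of _ y3] simp: add_divide_distrib)
qed

section \<open>Compactness\<close>

lemma power4_add_le: "(x + y) ^ 4 \<le> 8 * (x ^ 4 + y ^ 4)" for x y :: real
proof -
  have sq: "(s + t)\<^sup>2 \<le> 2 * (s\<^sup>2 + t\<^sup>2)" for s t :: real
    using zero_le_power2[of "s - t"] by (simp add: power2_sum power2_diff)
  have "((x + y)\<^sup>2)\<^sup>2 \<le> (2 * (x\<^sup>2 + y\<^sup>2))\<^sup>2" by (intro power_mono sq) simp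
  also have "\<dots> = 4 * (x\<^sup>2 + y\<^sup>2)\<^sup>2" by (simp only: power_mult_distrib) simp
  also have "\<dots> \<le> 4 * (2 * ((x\<^sup>2)\<^sup>2 + (y\<^sup>2)\<^sup>2))" by (intro mult_left_mono sq) simp
  finally show ?thesis by (simp flip: power_mult)
qed

text \<open>For 1 \<le> p \<le> 4 the power t^p is at most t + t^4, and splitting at t = \<delta>
  absorbs the linear term. On a finite measure space this does the work of Hoelder's
  inequality.\<close>

lemma powr_le_power4:
  fixes t \<delta> p :: real
  assumes "t \<ge> 0" "\<delta> > 0" "1 \<le> p" "p \<le> 4"
  shows "t powr p \<le> \<delta> + (1 + 1 / \<delta> ^ 3) * t ^ 4"
proof -
  have "t powr p \<le> t + t ^ 4"
  proof (cases "t \<le> 1")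
    case True
    then have "t powr p \<le> t powr 1" using assms by (intro powr_mono') auto
    then show ?thesis using assms by (simp add: add_increasing2)
  next
    case False
    then have "t powr p \<le> t powr 4" using assms by (intro powr_mono) auto
    also have "t powr 4 = t ^ 4" using False by (simp add: powr_numeral)
    finally show ?thesis using assms by simp
  qed
  moreover have "t \<le> \<delta> + t ^ 4 / \<delta> ^ 3"
  proof (cases "t \<le> \<delta>")
    case False
    then have "t * \<delta> ^ 3 \<le> t * t ^ 3" using assms by (intro mult_left_mono power_mono) auto
    also have "\<dots> = t ^ 4" by (simp add: power_Suc[symmetric] del: power_Suc)
    finally have "t \<le> t ^ 4 / \<delta> ^ 3" using assms by (simp add: pos_le_divide_eq)
    then show ?thesis using assms by simp
  qed (use assms in \<open>simp add: add_increasing2\<close>)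
  ultimately show ?thesis by (simp add: algebra_simps)
qed

lemma (in finite_measure) integrable_power4_imp_powr:
  fixes h :: "'a \<Rightarrow> real"
  assumes h: "h \<in> borel_measurable M" and h4: "integrable M (\<lambda>x. h x ^ 4)"
    and p: "1 \<le> p" "p \<le> 4"
  shows "integrable M (\<lambda>x. \<bar>h x\<bar> powr p)"
proof (rule Bochner_Integration.integrable_bound)
  show "integrable M (\<lambda>x. 1 + 2 * h x ^ 4)" using h4 by simp
  show "(\<lambda>x. \<bar>h x\<bar> powr p) \<in> borel_measurable M" using h by measurable
  show "AE x in M. norm (\<bar>h x\<bar> powr p) \<le> norm (1 + 2 * h x ^ 4)"
    using powr_le_power4[of "\<bar>h _\<bar>" 1 p] p by (intro AE_I2) simp
qed

lemma (in finite_measure) L4_tendsto_imp_Lp_tendsto: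
  fixes h :: "nat \<Rightarrow> 'a \<Rightarrow> real"
  assumes h: "\<And>k. h k \<in> borel_measurable M" and h4: "\<And>k. integrable M (\<lambda>x. h k x ^ 4)"
    and lim: "(\<lambda>k. LINT x|M. h k x ^ 4) \<longlonglongrightarrow> 0" and p: "1 \<le> p" "p \<le> 4"
  shows "(\<lambda>k. LINT x|M. \<bar>h k x\<bar> powr p) \<longlonglongrightarrow> 0"
proof (rule LIMSEQ_I)
  fix e :: real assume e: "e > 0"
  define m where "m = measure M (space M)"
  \<comment> \<open>Using m + 1 avoids a division by zero on a null space and makes \<delta> m
    strictly smaller than e/2.\<close>
  define \<delta> where "\<delta> = e / (2 * (m + 1))"
  have m: "m \<ge> 0" by (simp add: m_def)
  have \<delta>: "\<delta> > 0" using e m by (simp add: \<delta>_def)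
  have "\<delta> * m < e / 2"
  proof -
    have "\<delta> * m < \<delta> * (m + 1)" using \<delta> by simp
    also have "\<delta> * (m + 1) = e / 2" using m by (simp add: \<delta>_def divide_simps)
    finally show ?thesis .
  qed
  define C where "C = 1 + 1 / \<delta> ^ 3"
  have "(\<lambda>k. C * (LINT x|M. h k x ^ 4)) \<longlonglongrightarrow> 0" using tendsto_mult_left[OF lim, of C] by simp
  then have "\<forall>\<^sub>F k in sequentially. C * (LINT x|M. h k x ^ 4) < e / 2"
    using e by (intro order_tendstoD(2)) auto
  then obtain K where K: "\<And>k. k \<ge> K \<Longrightarrow> C * (LINT x|M. h k x ^ 4) < e / 2"
    unfolding eventually_sequentially by blast
  show "\<exists>K. \<forall>k\<ge>K. norm ((LINT x|M. \<bar>h k x\<bar> powr p) - 0) < e"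
  proof (intro exI[of _ K] allI impI)
    fix k assume "k \<ge> K"
    have "(LINT x|M. \<bar>h k x\<bar> powr p) \<le> (LINT x|M. \<delta> + C * h k x ^ 4)"
    proof (rule integral_mono)
      show "\<bar>h k x\<bar> powr p \<le> \<delta> + C * h k x ^ 4" for x
        using powr_le_power4[of "\<bar>h k x\<bar>" \<delta> p] \<delta> p by (simp add: C_def)
    qed (use h4 integrable_power4_imp_powr[OF h h4 p] in simp_all)
    also have "\<dots> = \<delta> * m + C * (LINT x|M. h k x ^ 4)" using h4 by (simp add: m_def)
    also have "\<dots> < e" using K[OF \<open>k \<ge> K\<close>] \<open>\<delta> * m < e / 2\<close> by simp
    finally show "norm ((LINT x|M. \<bar>h k x\<bar> powr p) - 0) < e" by simp
  qed
qed

section \<open>The sign with hysteresis and limits of step functions\<close>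

lemma prod_sign_card:
  "finite A \<Longrightarrow> (\<Prod>j\<in>A. if P j then -1 else 1 :: real) = (-1) ^ card {j\<in>A. P j}"
  by (simp add: prod.If_cases Int_def)

text \<open>If z has the sign of s, then |z - s| = ||z| - 1|. Otherwise |z| \<le> 1/2, so |z - s|
  \<le> 3/2 while ||z| - 1| \<ge> 1/2; this is the origin of the factor 3, and 81 = 3^4. Two of the
  four factors |z| - 1 are then enlarged to |z| + 1.\<close>

lemma power4_dist_sign_le:
  fixes z s :: real
  assumes s: "s = 1 \<or> s = -1" and z: "s * z \<ge> - (1 / 2)"
  shows "(z - s) ^ 4 \<le> 81 * (z\<^sup>2 - 1)\<^sup>2"
proof -
  have "\<bar>z - s\<bar> \<le> 3 * \<bar>\<bar>z\<bar> - 1\<bar>" using s z by (elim disjE) (auto simp: abs_if)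
  then have "\<bar>z - s\<bar> ^ 4 \<le> (3 * \<bar>\<bar>z\<bar> - 1\<bar>) ^ 4" by (intro power_mono) auto
  also have "\<dots> = 81 * ((\<bar>z\<bar> - 1)\<^sup>2 * (\<bar>z\<bar> - 1)\<^sup>2)"
    by (simp add: power_mult_distrib flip: power_add)
  also have "\<dots> \<le> 81 * ((\<bar>z\<bar> - 1)\<^sup>2 * (\<bar>z\<bar> + 1)\<^sup>2)"
    by (intro mult_left_mono) (auto simp: abs_le_square_iff[symmetric])
  also have "(\<bar>z\<bar> - 1)\<^sup>2 * (\<bar>z\<bar> + 1)\<^sup>2 = ((\<bar>z\<bar> - 1) * (\<bar>z\<bar> + 1))\<^sup>2" by (simp add: power_mult_distrib)
  also have "(\<bar>z\<bar> - 1) * (\<bar>z\<bar> + 1) = z\<^sup>2 - 1"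
    by (simp add: algebra_simps power2_eq_square flip: abs_mult)
  finally show ?thesis by simp
qed

text \<open>This is \<open>(-1)\<close> to the maximal number (up to \<open>N\<close>) of alternations of \<open>v\<close> to the left of \<open>x\<close>.\<close>

definition hysteresis_sign :: "real set \<Rightarrow> nat \<Rightarrow> (real \<Rightarrow> real) \<Rightarrow> real \<Rightarrow> real" where
  "hysteresis_sign \<Omega> N v x = (\<Prod>j\<in>{1..N}. if alternates \<Omega> v j x then -1 else 1)"

text \<open>Let m be the number of alternations up to x. If (-1)^m v(x) \<le> -1/2, then x itself
  would be an alternation point number m + 1. The hypothesis on N gives m \<le> N, so the product
  misses no alternation.\<close>

lemma hysteresis_sign_close:
  assumes x: "x \<in> \<Omega>" and N: "\<not> alternates \<Omega> v (Suc N) x"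
  shows "(v x - hysteresis_sign \<Omega> N v x) ^ 4 \<le> 81 * ((v x)\<^sup>2 - 1)\<^sup>2"
proof -
  define m where "m = (LEAST j. \<not> alternates \<Omega> v (Suc j) x)"
  have m: "\<not> alternates \<Omega> v (Suc m) x" unfolding m_def using N by (rule LeastI)
  have mN: "m \<le> N" unfolding m_def using N by (rule Least_le)
  have "alternates \<Omega> v m x"
  proof (cases m)
    case (Suc k)
    then have "k < (LEAST j. \<not> alternates \<Omega> v (Suc j) x)" unfolding m_def[symmetric] by (simp only: lessI)
    from not_less_Least[OF this] show ?thesis unfolding Suc by blast
  qed simp
  then have iff: "alternates \<Omega> v j x \<longleftrightarrow> j \<le> m" for j
    using m alternates_antimono by (metis not_less_eq_eq)
  have "{j \<in> {1..N}. alternates \<Omega> v j x} = {1..m}" using mN by (auto simp: iff)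
  then have w: "hysteresis_sign \<Omega> N v x = (-1) ^ m"
    by (simp add: hysteresis_sign_def prod_sign_card)
  have "\<not> (-1) ^ Suc m * v x \<ge> 1/2"
    using m x \<open>alternates \<Omega> v m x\<close> unfolding alternates.simps(2) by blast
  then have "(-1) ^ m * v x \<ge> - (1/2)" by simp
  then show ?thesis unfolding w
    by (intro power4_dist_sign_le) (cases "even m"; simp)
qed

lemma monotone_predicate_measurable:
  fixes P :: "real \<Rightarrow> bool"
  assumes "\<And>x y. P x \<Longrightarrow> x \<le> y \<Longrightarrow> P y"
  shows "(\<lambda>x. if P x then -1 else 1 :: real) \<in> borel_measurable borel"
proof -
  have "mono (\<lambda>x. if P x then 1 else -1 :: real)" using assms by (auto intro!: monoI)
  from borel_measurable_uminus[OF borel_measurable_mono[OF this]]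
  show ?thesis by (rule measurable_cong[THEN iffD1, rotated]) auto
qed

lemma hysteresis_sign_measurable: "hysteresis_sign \<Omega> N v \<in> borel_measurable borel"
  unfolding hysteresis_sign_def[abs_def]
  by (intro borel_measurable_prod monotone_predicate_measurable) (rule alternates_mono)

lemma monotone_predicate_threshold:
  fixes P :: "real \<Rightarrow> bool"
  assumes P: "\<And>x y. P x \<Longrightarrow> x \<le> y \<Longrightarrow> P y" and ab: "a \<le> b"
  shows "\<exists>T\<in>{a..b}. \<forall>x\<in>{a<..<b}. (x < T \<longrightarrow> \<not> P x) \<and> (T < x \<longrightarrow> P x)"
proof -
  \<comment> \<open>Inserting b keeps the set nonempty, with infimum b, when P holds nowhere in the
    interval.\<close>
  define S where "S = insert b {x \<in> {a..b}. P x}"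
  have bdd: "bdd_below S" and ne: "S \<noteq> {}" and sub: "S \<subseteq> {a..b}"
    using ab by (auto simp: S_def intro!: bdd_belowI[of _ a])
  have "Inf S \<in> {a..b}"
    using cInf_greatest[OF ne, of a] cInf_lower[OF _ bdd, of b] sub by (auto simp: S_def)
  moreover have "\<not> P x" if "x \<in> {a<..<b}" "x < Inf S" for x
    using cInf_lower[OF _ bdd, of x] that by (auto simp: S_def)
  moreover have "P x" if x: "x \<in> {a<..<b}" "Inf S < x" for x
  proof -
    obtain y where "y \<in> S" "y < x" using cInf_lessD[OF ne x(2)] by blast
    then show ?thesis using x P[of y x] by (auto simp: S_def)
  qed
  ultimately show ?thesis by blast
qed

text \<open>Bolzano-Weierstrass one coordinate at a time; limits already obtained survive further
  extraction.\<close>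

lemma simultaneous_convergent_subseq:
  fixes T :: "nat \<Rightarrow> nat \<Rightarrow> real"
  assumes "\<And>n j. T n j \<in> {a..b}"
  shows "\<exists>r \<tau>. strict_mono (r :: nat \<Rightarrow> nat) \<and> (\<forall>j\<le>N. (\<lambda>k. T (r k) j) \<longlonglongrightarrow> \<tau> j)"
proof (induction N)
  case 0
  have "\<forall>n. T n 0 \<in> {a..b}" using assms by blast
  with compact_imp_seq_compact[OF compact_Icc, of a b] obtain l r where
    "strict_mono r" "((\<lambda>n. T n 0) \<circ> r) \<longlonglongrightarrow> l" unfolding seq_compact_def by metis
  then show ?case by (intro exI[of _ r] exI[of _ "\<lambda>_. l"]) (simp add: o_def)
next
  case (Suc N)
  then obtain r \<tau> where r: "strict_mono (r :: nat \<Rightarrow> nat)" "\<And>j. j \<le> N \<Longrightarrow> (\<lambda>k. T (r k) j) \<longlonglongrightarrow> \<tau> j" by blast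
  have "\<forall>n. T (r n) (Suc N) \<in> {a..b}" using assms by blast
  with compact_imp_seq_compact[OF compact_Icc, of a b] obtain l s where
    s: "strict_mono s" "((\<lambda>n. T (r n) (Suc N)) \<circ> s) \<longlonglongrightarrow> l" unfolding seq_compact_def by metis
  have "(\<lambda>k. T ((r \<circ> s) k) j) \<longlonglongrightarrow> (\<tau>(Suc N := l)) j" if "j \<le> Suc N" for j
  proof (cases "j = Suc N")
    case True
    then show ?thesis using s(2) by (simp add: o_def)
  next
    case False
    then have "((\<lambda>k. T (r k) j) \<circ> s) \<longlonglongrightarrow> \<tau> j"
      using that by (intro LIMSEQ_subseq_LIMSEQ[OF r(2) s(1)]) simp
    then show ?thesis using False by (simp add: o_def)
  qed
  then show ?case using strict_mono_o[OF r(1) s(1)] by blast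
qed

text \<open>Away from the limit thresholds every single factor is eventually constant. Keeping the
  product form spares any case distinction for thresholds that merge or run into an
  endpoint.\<close>

lemma step_sign_convergent_subseq:
  fixes P :: "nat \<Rightarrow> nat \<Rightarrow> real \<Rightarrow> bool"
  assumes ab: "a \<le> b" and P: "\<And>n j x y. P n j x \<Longrightarrow> x \<le> y \<Longrightarrow> P n j y"
  obtains r \<tau> where "strict_mono (r :: nat \<Rightarrow> nat)"
    and "\<And>x. x \<in> {a<..<b} \<Longrightarrow> x \<notin> \<tau> ` {1..N} \<Longrightarrow> \<forall>\<^sub>F k in sequentially.
      (\<Prod>j\<in>{1..N}. if P (r k) j x then -1 else 1 :: real) = (\<Prod>j\<in>{1..N}. if \<tau> j < x then -1 else 1)"
proof -
  have "\<forall>n j. \<exists>T\<in>{a..b}. \<forall>x\<in>{a<..<b}. (x < T \<longrightarrow> \<not> P n j x) \<and> (T < x \<longrightarrow> P n j x)"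
    by (intro allI monotone_predicate_threshold[OF _ ab]) (rule P)
  then obtain T where T: "\<And>n j. T n j \<in> {a..b}"
    and T': "\<And>n j x. x \<in> {a<..<b} \<Longrightarrow> x < T n j \<Longrightarrow> \<not> P n j x" "\<And>n j x. x \<in> {a<..<b} \<Longrightarrow> T n j < x \<Longrightarrow> P n j x"
    by metis
  obtain r \<tau> where r: "strict_mono (r :: nat \<Rightarrow> nat)" "\<And>j. j \<le> N \<Longrightarrow> (\<lambda>k. T (r k) j) \<longlonglongrightarrow> \<tau> j"
    using simultaneous_convergent_subseq[where T = T and N = N, OF T] by blast
  show ?thesis
  proof (rule that[OF r(1)])
    fix x assume x: "x \<in> {a<..<b}" "x \<notin> \<tau> ` {1..N}"
    have "\<forall>\<^sub>F k in sequentially. P (r k) j x \<longleftrightarrow> \<tau> j < x" if j: "j \<in> {1..N}" for j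
    proof (cases "\<tau> j < x")
      case True
      then have "\<forall>\<^sub>F k in sequentially. T (r k) j < x"
        using order_tendstoD(2)[OF r(2)] j by simp
      then show ?thesis using True T'(2)[OF x(1)] by (auto elim!: eventually_mono)
    next
      case False
      then have "x < \<tau> j" using x(2) j by (auto simp: not_less less_le)
      then have "\<forall>\<^sub>F k in sequentially. x < T (r k) j"
        using order_tendstoD(1)[OF r(2)] j by simp
      then show ?thesis using False T'(1)[OF x(1)] by (auto elim!: eventually_mono)
    qed
    then have "\<forall>\<^sub>F k in sequentially. \<forall>j\<in>{1..N}. P (r k) j x \<longleftrightarrow> \<tau> j < x"
      by (intro eventually_ball_finite) auto
    then show "\<forall>\<^sub>F k in sequentially.
      (\<Prod>j\<in>{1..N}. if P (r k) j x then -1 else 1 :: real) = (\<Prod>j\<in>{1..N}. if \<tau> j < x then -1 else 1)"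
      by eventually_elim (auto intro!: prod.cong)
  qed
qed

text \<open>The number of thresholds passed is nondecreasing in x, and a change of sign costs 2 only
  if that number grows by at least 1. The variation sums therefore telescope to at most 2N.\<close>

lemma step_sign_BPV:
  fixes a b p :: real and \<tau> :: "nat \<Rightarrow> real" and N :: nat
  defines "w \<equiv> \<lambda>x. \<Prod>j\<in>{1..N}. if \<tau> j < x then -1 else 1 :: real"
  shows "w \<in> borel_measurable borel" and "w x \<in> {-1, 1}" and "w \<in> BPV_pm1 {a<..<b} p"
proof -
  show meas: "w \<in> borel_measurable borel"
    unfolding w_def by (intro borel_measurable_prod monotone_predicate_measurable) auto
  define S where "S x = {j \<in> {1..N}. \<tau> j < x}" for x
  have w: "w x = (-1) ^ card (S x)" for x by (simp add: w_def S_def prod_sign_card)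
  show pm: "w x \<in> {-1, 1}" for x unfolding w by (cases "even (card (S x))") auto
  have fin: "finite (S x)" for x by (simp add: S_def)
  have mono: "S x \<subseteq> S y" if "x \<le> y" for x y using that by (auto simp: S_def)
  have jump: "\<bar>w y - w x\<bar> \<le> 2 * (real (card (S y)) - real (card (S x)))" if "x \<le> y" for x y
  proof (cases "S x = S y")
    case False
    then have "card (S x) < card (S y)" using mono[OF that] fin by (intro psubset_card_mono) auto
    then have "real (Suc (card (S x))) \<le> real (card (S y))" by (simp only: of_nat_le_iff Suc_le_eq)
    then have "2 \<le> 2 * (real (card (S y)) - real (card (S x)))" by simp
    moreover have "\<bar>w y - w x\<bar> \<le> 2" using pm[of x] pm[of y] by auto
    ultimately show ?thesis by linarith
  qed (simp add: w)
  have tele: "(\<Sum>i\<in>{1..n}. \<bar>w (x i) - w (x (i - 1))\<bar>) \<le> 2 * (real (card (S (x n))) - real (card (S (x 0))))"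
    if "\<forall>i<n. x i < x (Suc i)" for n and x :: "nat \<Rightarrow> real"
    using that
  proof (induction n)
    case (Suc n)
    then have "\<bar>w (x (Suc n)) - w (x n)\<bar> \<le> 2 * (real (card (S (x (Suc n)))) - real (card (S (x n))))"
      by (intro jump) (auto intro: less_imp_le)
    then show ?case using Suc by simp
  qed simp
  have bound: "(\<Sum>i\<in>{1..n}. \<bar>w (x i) - w (x (i - 1))\<bar>) \<le> 2 * real N"
    if "\<forall>i<n. x i < x (Suc i)" for n and x :: "nat \<Rightarrow> real"
  proof -
    have "card (S (x n)) \<le> card {1..N}" by (rule card_mono) (auto simp: S_def)
    then have "real (card (S (x n))) \<le> real N" by simp
    then have "real (card (S (x n))) - real (card (S (x 0))) \<le> real N"
      using of_nat_0_le_iff[of "card (S (x 0))", where 'a = real] by linarith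
    then have "2 * (real (card (S (x n))) - real (card (S (x 0)))) \<le> 2 * real N" by (rule mult_left_mono) simp
    with tele[OF that] show ?thesis by (rule order_trans)
  qed
  have "var_on {a<..<b} w \<le> ereal (2 * real N)"
    unfolding var_on_def by (rule SUP_least) (auto simp del: One_nat_def intro!: bound)
  moreover have "ess_var_on {a<..<b} w \<le> var_on {a<..<b} w"
    unfolding ess_var_on_def by (rule INF_lower) simp
  ultimately have "ess_var_on {a<..<b} w < \<infinity>"
    using less_ereal.simps(4) order_le_less_trans order_trans by metis
  moreover have "Lp {a<..<b} p w"
  proof -
    have "\<bar>w x\<bar> = 1" for x using pm[of x] by auto
    then show ?thesis unfolding Lp_def
      using meas finite_measure.integrable_const[OF finite_measure_lebesgue_on[of "{a<..<b}"], of 1]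
      by (simp add: borel_measurable_lebesgue_on)
  qed
  ultimately show "w \<in> BPV_pm1 {a<..<b} p" using pm by (simp add: BPV_pm1_def)
qed

text \<open>Beyond this point the energy enters only through two consequences: the well integral is
  O(\<epsilon>), and 2q + 1 alternations are impossible, as they would cost q/16 > M.\<close>

lemma bounded_energy_alternations:
  fixes a b p M \<epsilon> :: real
  assumes ab: "a < b" and p: "p \<ge> 1" and eps: "\<epsilon> > 0" and F: "F_eps {a<..<b} p \<epsilon> u \<le> ereal M"
    and q: "16 * M < real q"
  obtains v where "AE x in lebesgue_on {a<..<b}. u x = v x"
    and "\<And>x. \<not> alternates {a<..<b} v (Suc (2 * q)) x"
    and "integrable (lebesgue_on {a<..<b}) (\<lambda>x. ((u x)\<^sup>2 - 1)\<^sup>2)"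
    and "(LINT x|lebesgue_on {a<..<b}. ((u x)\<^sup>2 - 1)\<^sup>2) \<le> M * \<epsilon>"
proof -
  let ?M = "lebesgue_on {a<..<b}"
  let ?g = "weak_deriv2 {a<..<b} p u"
  have W: "W2p {a<..<b} p u" using F unfolding F_eps_def by (auto split: if_splits)
  then have u[measurable]: "u \<in> borel_measurable ?M" by (simp add: W2p_def Lp_def)
  obtain v v' where uv: "AE x in ?M. u x = v x"
    and dv: "\<And>x. x \<in> {a<..<b} \<Longrightarrow> (v has_real_derivative v' x) (at x)"
    and dv': "\<And>x y. a < x \<Longrightarrow> x \<le> y \<Longrightarrow> y < b \<Longrightarrow> v' y - v' x = integral {x..y} ?g"
    and g: "integrable ?M ?g"
    using W2p_regular_representative[OF ab p W] by blast
  have [measurable]: "?g \<in> borel_measurable ?M" using g by (rule borel_measurable_integrable)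
  have "continuous_on {a<..<b} v" using dv by (meson DERIV_isCont continuous_at_imp_continuous_on)
  then have [measurable]: "v \<in> borel_measurable ?M"
    by (rule continuous_imp_measurable_on_sets_lebesgue) simp
  let ?e = "energy_density \<epsilon> u ?g"
  have e_meas: "energy_density \<epsilon> f ?g \<in> borel_measurable ?M" if [measurable]: "f \<in> borel_measurable ?M" for f
    unfolding energy_density_def[abs_def] by measurable
  have "enn2ereal (\<integral>\<^sup>+ x. ennreal (?e x) \<partial>?M) \<le> ereal M"
    using F W by (simp add: F_eps_def energy_density_def power2_abs)
  then have nn: "(\<integral>\<^sup>+ x. ennreal (?e x) \<partial>?M) \<le> ennreal M"
    by (metis e2ennreal_enn2ereal e2ennreal_ereal e2ennreal_mono)
  have M: "M \<ge> 0"
    using \<open>enn2ereal _ \<le> ereal M\<close> enn2ereal_nonneg[of "\<integral>\<^sup>+ x. ennreal (?e x) \<partial>?M"] by (metis ereal_less_eq(5) order_trans)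
  have e_int: "integrable ?M ?e"
    using nn eps e_meas[OF u] by (intro integrableI_nonneg) (auto simp: energy_density_nonneg less_top[symmetric] top_unique intro: le_less_trans)
  have e_le: "integral\<^sup>L ?M ?e \<le> M"
    using nn M nn_integral_eq_integral[OF e_int] eps by (simp add: energy_density_nonneg)
  have well: "integrable ?M (\<lambda>x. ((u x)\<^sup>2 - 1)\<^sup>2 / \<epsilon>)"
    by (rule Bochner_Integration.integrable_bound[OF e_int]) (use eps in \<open>auto simp: energy_density_def\<close>)
  have "(LINT x|?M. ((u x)\<^sup>2 - 1)\<^sup>2 / \<epsilon>) \<le> integral\<^sup>L ?M ?e"
    using well e_int eps by (intro integral_mono) (auto simp: energy_density_ge_potential)
  then have "(LINT x|?M. ((u x)\<^sup>2 - 1)\<^sup>2) \<le> integral\<^sup>L ?M ?e * \<epsilon>"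
    using eps by (simp add: pos_divide_le_eq)
  also have "\<dots> \<le> M * \<epsilon>" using eps by (intro mult_right_mono e_le) simp
  finally have well_le: "(LINT x|?M. ((u x)\<^sup>2 - 1)\<^sup>2) \<le> M * \<epsilon>" .
  have "integrable ?M (\<lambda>x. \<epsilon> ^ 3 * (?g x)\<^sup>2)"
    by (rule Bochner_Integration.integrable_bound[OF e_int]) (use eps in \<open>auto simp: energy_density_def\<close>)
  then have g2: "integrable ?M (\<lambda>x. (?g x)\<^sup>2)" using eps by simp
  \<comment> \<open>The bump estimate needs pointwise values and hence v, while the energy bound is
    given for u; both densities share the same g and agree almost everywhere.\<close>
  have ev: "AE x in ?M. ?e x = energy_density \<epsilon> v ?g x"
    using uv by eventually_elim (simp add: energy_density_def)
  have ev_int: "integrable ?M (energy_density \<epsilon> v ?g)"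
    by (rule integrable_cong_AE_imp[OF e_int e_meas ev]) simp
  have ev_le: "integral\<^sup>L ?M (energy_density \<epsilon> v ?g) \<le> M"
    using e_le integral_cong_AE[OF e_meas[OF u] e_meas ev] by simp
  have HK: "f integrable_on {a..b}" if "integrable ?M f" for f :: "real \<Rightarrow> real"
    using integral_indicator_subinterval(1)[OF that order_refl order_refl]
    by (rule set_lebesgue_integral_eq_integral(1))
  have "\<not> alternates {a<..<b} v (Suc (2 * q)) x" for x
  proof
    assume "alternates {a<..<b} v (Suc (2 * q)) x"
    then have "alternates {a<..<b} v (2 * q + 1) x" by (simp only: Suc_eq_plus1)
    from alternates_energy[OF eps dv dv' HK[OF g] HK[OF g2] HK[OF ev_int] this]
    obtain y where y: "y \<in> {a<..<b}" "real q / 16 \<le> integral {a..y} (energy_density \<epsilon> v ?g)" by blast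
    note y(2)
    also have "integral {a..y} (energy_density \<epsilon> v ?g) \<le> integral {a..b} (energy_density \<epsilon> v ?g)"
      using y(1) eps by (intro integral_subset_le HK[OF ev_int] integrable_on_subinterval[OF HK[OF ev_int]])
        (auto simp: energy_density_nonneg)
    also have "\<dots> = (LINT t|?M. indicator {a<..<b} t * energy_density \<epsilon> v ?g t)"
      using integral_indicator_subinterval(2)[OF ev_int order_refl order_refl] by simp
    also have "\<dots> = integral\<^sup>L ?M (energy_density \<epsilon> v ?g)"
      by (intro Bochner_Integration.integral_cong) auto
    also note ev_le
    finally show False using q by simp
  qed
  moreover have "integrable ?M (\<lambda>x. ((u x)\<^sup>2 - 1)\<^sup>2)"
    using integrable_mult_right[OF well, of \<epsilon>] eps by simp
  ultimately show ?thesis using that uv well_le by blast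
qed

theorem theorem1p2:
  fixes a b p :: real and \<epsilon> :: "nat \<Rightarrow> real" and u :: "nat \<Rightarrow> real \<Rightarrow> real"
  assumes "a < b" and "1 \<le> p" and "p \<le> 4"
    and "\<And>n. \<epsilon> n > 0" and "\<epsilon> \<longlonglongrightarrow> 0"
    and "\<And>n. Lp {a<..<b} p (u n)"
    and "(SUP n. \<bar>F_eps {a<..<b} p (\<epsilon> n) (u n)\<bar>) < \<infinity>"
  shows "\<exists>r w. strict_mono r \<and> w \<in> BPV_pm1 {a<..<b} p \<and>
           (\<lambda>k. LINT x|lebesgue_on {a<..<b}. \<bar>u (r k) x - w x\<bar> powr p) \<longlonglongrightarrow> 0"
proof -
  let ?M = "lebesgue_on {a<..<b}"
  let ?F = "\<lambda>n. F_eps {a<..<b} p (\<epsilon> n) (u n)"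
  interpret finite_measure ?M by (rule finite_measure_lebesgue_on) simp
  define S where "S = (SUP n. \<bar>?F n\<bar>)"
  have FS: "\<bar>?F n\<bar> \<le> S" for n unfolding S_def by (rule SUP_upper) simp
  have "0 \<le> S" using FS[of 0] by (rule order_trans[rotated]) simp
  moreover have "S < \<infinity>" using assms(7) by (simp add: S_def)
  ultimately obtain C where "S = ereal C" by (cases S) auto
  moreover have "?F n \<le> \<bar>?F n\<bar>" for n by (cases "?F n") auto
  ultimately have F: "?F n \<le> ereal C" for n using FS[of n] by (metis order_trans)
  \<comment> \<open>The 16 is the inverse of the cost of one bump. Since 2q + 1 alternations are
    excluded, N = 2q factors suffice for every n at once.\<close>
  obtain q where q: "16 * C < real q" using reals_Archimedean2 by blast
  define N where "N = 2 * q"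
  have "\<exists>v. (AE x in ?M. u n x = v x) \<and> (\<forall>x. \<not> alternates {a<..<b} v (Suc N) x) \<and>
      integrable ?M (\<lambda>x. ((u n x)\<^sup>2 - 1)\<^sup>2) \<and> (LINT x|?M. ((u n x)\<^sup>2 - 1)\<^sup>2) \<le> C * \<epsilon> n" for n
    unfolding N_def by (rule bounded_energy_alternations[OF assms(1,2) assms(4)[of n] F[of n] q]) blast
  then obtain v where uv: "\<And>n. AE x in ?M. u n x = v n x"
    and alt: "\<And>n x. \<not> alternates {a<..<b} (v n) (Suc N) x"
    and well: "\<And>n. integrable ?M (\<lambda>x. ((u n x)\<^sup>2 - 1)\<^sup>2)"
    and well_le: "\<And>n. (LINT x|?M. ((u n x)\<^sup>2 - 1)\<^sup>2) \<le> C * \<epsilon> n" by metis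
  let ?W = "\<lambda>n. hysteresis_sign {a<..<b} N (v n)"
  have W_pm: "?W n x \<in> {-1, 1}" for n x
    unfolding hysteresis_sign_def prod_sign_card[OF finite_atLeastAtMost]
    by (cases "even (card {j \<in> {1..N}. alternates {a<..<b} (v n) j x})") auto
  obtain r \<tau> where r: "strict_mono (r :: nat \<Rightarrow> nat)"
    and conv: "\<And>x. x \<in> {a<..<b} \<Longrightarrow> x \<notin> \<tau> ` {1..N} \<Longrightarrow> \<forall>\<^sub>F k in sequentially.
      ?W (r k) x = (\<Prod>j\<in>{1..N}. if \<tau> j < x then -1 else 1)"
    unfolding hysteresis_sign_def
    by (rule step_sign_convergent_subseq[where P = "\<lambda>n. alternates {a<..<b} (v n)" and N = N,
        OF less_imp_le[OF assms(1)]]) (erule alternates_mono, assumption, blast)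
  define w where "w x = (\<Prod>j\<in>{1..N}. if \<tau> j < x then -1 else 1 :: real)" for x
  note w = step_sign_BPV[where N = N and \<tau> = \<tau>, folded w_def]
  have [measurable]: "u n \<in> borel_measurable ?M" for n using assms(6)[of n] by (simp add: Lp_def)
  have [measurable]: "w \<in> borel_measurable ?M" using w(1) by (rule borel_measurable_lebesgue_on)
  have [measurable]: "?W n \<in> borel_measurable ?M" for n
    by (intro borel_measurable_lebesgue_on hysteresis_sign_measurable)
  have Ww_le: "(?W n x - w x) ^ 4 \<le> 16" for n x
    using W_pm[of n x] w(2)[of x] by auto
  have Ww_int: "integrable ?M (\<lambda>x. (?W n x - w x) ^ 4)" for n
    by (rule integrable_const_bound[where B = 16]) (use Ww_le in auto)
  \<comment> \<open>Here 648 = 8 * 81: the factor 8 comes from splitting the fourth power of a sum,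
    81 from the distance of v to its hysteresis sign.\<close>
  have dist: "AE x in ?M. (u n x - w x) ^ 4 \<le> 648 * ((u n x)\<^sup>2 - 1)\<^sup>2 + 8 * (?W n x - w x) ^ 4" for n
    using uv[of n] AE_space
  proof eventually_elim
    case (elim x)
    have "(u n x - w x) ^ 4 = ((u n x - ?W n x) + (?W n x - w x)) ^ 4" by simp
    also have "\<dots> \<le> 8 * ((u n x - ?W n x) ^ 4 + (?W n x - w x) ^ 4)" by (rule power4_add_le)
    also have "(u n x - ?W n x) ^ 4 \<le> 81 * ((u n x)\<^sup>2 - 1)\<^sup>2"
      using hysteresis_sign_close[OF _ alt] elim by simp
    finally show ?case by simp
  qed
  have bound_int: "integrable ?M (\<lambda>x. 648 * ((u n x)\<^sup>2 - 1)\<^sup>2 + 8 * (?W n x - w x) ^ 4)" for n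
    using well Ww_int by simp
  have uw_int: "integrable ?M (\<lambda>x. (u n x - w x) ^ 4)" for n
    by (rule Bochner_Integration.integrable_bound[OF bound_int[of n]]) (use dist[of n] in \<open>auto elim!: eventually_mono\<close>)
  \<comment> \<open>Off the finitely many limit thresholds the integrand is eventually 0; two signs
    differ by at most 2, so 2^4 = 16 dominates.\<close>
  have "(\<lambda>k. LINT x|?M. (?W (r k) x - w x) ^ 4) \<longlonglongrightarrow> (LINT x|?M. 0)"
  proof (rule integral_dominated_convergence[where w = "\<lambda>_. 16"])
    have "AE x in lebesgue. x \<notin> \<tau> ` {1..N}"
      by (rule AE_not_in) (simp add: null_sets_completionI finite_imp_null_set_lborel)
    then have "AE x in ?M. x \<notin> \<tau> ` {1..N}" by (auto simp: AE_restrict_space_iff elim!: eventually_mono)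
    then show "AE x in ?M. (\<lambda>k. (?W (r k) x - w x) ^ 4) \<longlonglongrightarrow> 0"
      using AE_space
    proof eventually_elim
      case (elim x)
      then have "\<forall>\<^sub>F k in sequentially. ?W (r k) x = w x" using conv[of x] by (simp add: w_def)
      then show ?case by (intro tendsto_eventually) (auto elim: eventually_mono)
    qed
    show "AE x in ?M. norm ((?W (r k) x - w x) ^ 4) \<le> 16" for k using Ww_le by auto
  qed auto
  then have lim2: "(\<lambda>k. LINT x|?M. (?W (r k) x - w x) ^ 4) \<longlonglongrightarrow> 0" by simp
  have lim4: "(\<lambda>k. LINT x|?M. (u (r k) x - w x) ^ 4) \<longlonglongrightarrow> 0"
  proof (rule tendsto_sandwich)
    show "\<forall>\<^sub>F k in sequentially. 0 \<le> (LINT x|?M. (u (r k) x - w x) ^ 4)" by simp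
    show "\<forall>\<^sub>F k in sequentially. (LINT x|?M. (u (r k) x - w x) ^ 4) \<le>
        648 * (C * \<epsilon> (r k)) + 8 * (LINT x|?M. (?W (r k) x - w x) ^ 4)"
    proof (rule always_eventually, rule allI)
      fix k
      have "(LINT x|?M. (u (r k) x - w x) ^ 4) \<le>
          (LINT x|?M. 648 * ((u (r k) x)\<^sup>2 - 1)\<^sup>2 + 8 * (?W (r k) x - w x) ^ 4)"
        by (intro integral_mono_AE uw_int bound_int dist)
      also have "\<dots> = 648 * (LINT x|?M. ((u (r k) x)\<^sup>2 - 1)\<^sup>2) + 8 * (LINT x|?M. (?W (r k) x - w x) ^ 4)"
        using well Ww_int by simp
      also have "\<dots> \<le> 648 * (C * \<epsilon> (r k)) + 8 * (LINT x|?M. (?W (r k) x - w x) ^ 4)"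
        using well_le[of "r k"] by simp
      finally show "(LINT x|?M. (u (r k) x - w x) ^ 4) \<le>
        648 * (C * \<epsilon> (r k)) + 8 * (LINT x|?M. (?W (r k) x - w x) ^ 4)" .
    qed
    have "(\<lambda>k. \<epsilon> (r k)) \<longlonglongrightarrow> 0" using LIMSEQ_subseq_LIMSEQ[OF assms(5) r] by (simp add: o_def)
    from tendsto_add[OF tendsto_mult_left[OF tendsto_mult_left[OF this, of C], of 648] tendsto_mult_left[OF lim2, of 8]]
    show "(\<lambda>k. 648 * (C * \<epsilon> (r k)) + 8 * (LINT x|?M. (?W (r k) x - w x) ^ 4)) \<longlonglongrightarrow> 0" by simp
  qed simp
  have "(\<lambda>k. LINT x|?M. \<bar>u (r k) x - w x\<bar> powr p) \<longlonglongrightarrow> 0"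
    by (rule L4_tendsto_imp_Lp_tendsto[OF _ uw_int lim4 assms(2,3)]) simp
  with r w(3) show ?thesis by blast
qed

end
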